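(* Let $k\in\mathbb{N}$, $c\in\mathbb{C}\setminus(\mathbb{S}^1\cup\{0\})$, let $$\xi=\lambda^{-1}\begin{pmatrix} 0 & 1 \\ c z^k & 0 \end{pmatrix}\mathrm{d}z\qquad(z\in\mathbb{C})$$ be the radially symmetric potential and let $F_\lambda\in\Lambda\mathrm{SU}(1,1)_\sigma$ ($\lambda\in\mathbb{S}^1$) be the extended frame obtained from $\xi$. For $\ell\in\{0,1,\dots,k+1\}$ let $R_\ell(z)=e^{2\pi i\ell/(k+2)}\bar z$. Then the minimal Lagrangian surface $f^\lambda$ in $Q_2^*$ constructed from $(F_\lambda,F_{i\lambda})$ admits discrete rotational symmetries: $$\hat{\mathfrak f}^\lambda(R_\ell(z),\overline{R_\ell(z)},\lambda)=\mathcal{A}_\ell\,\hat{\mathfrak f}^\lambda(\bar z,z,\lambda),\qquad \mathcal{A}_\ell=\begin{pmatrix}1&0&0&0\\0&1&0&0\\0&0&\cos\left(\frac{2\pi\ell}{k+2}\right)&\sin\left(\frac{2\pi\ell}{k+2}\right)\\0&0&-\sin\left(\frac{2\pi\ell}{k+2}\right)&\cos\left(\frac{2\pi\ell}{k+2}\right)\end{pmatrix},$$ where $\hat{\mathfrak f}^\lambda$ denotes the horizontal lift of $f^\lambda$. Moreover, the induced metric of $f^\lambda$ depends only on the radial coordinate $|z|$. (Such a surface $f^\lambda$ is therefore called radially symmetric.)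
   Context: On $\mathbb{C}^4$ let $\langle \boldsymbol z,\boldsymbol w\rangle=-z_1w_1-z_2w_2+z_3w_3+z_4w_4$, $(\boldsymbol z,\boldsymbol w)=\langle\boldsymbol z,\overline{\boldsymbol w}\rangle$. $\mathbb{CH}^3_1=\{[\boldsymbol z]\in\mathbb{C}P^3:(\boldsymbol z,\boldsymbol z)<0\}$ has the indefinite Kähler structure induced by the Hopf fibration from $\mathbb{H}^7_3(-1)=\{(\boldsymbol z,\boldsymbol z)=-1\}$, and $Q_2^*$ is a connected component of $\{[\boldsymbol z]\in\mathbb{CH}^3_1:\langle\boldsymbol z,\boldsymbol z\rangle=0\}$ (the one containing $[(1,i,0,0)]$), with the induced Kähler structure. A lift $\mathfrak f$ of a surface $f$ to $\mathbb{H}^7_3(-1)$ is horizontal if $\langle\mathfrak f_z,\bar{\mathfrak f}\rangle=\langle\mathfrak f_{\bar z},\bar{\mathfrak f}\rangle=0$. $\mathrm{SU}(1,1)=\{A\in\mathrm{SL}(2,\mathbb{C}):\bar A^T\mathrm{diag}(1,-1)A=\mathrm{diag}(1,-1)\}$. For $G=\mathrm{SU}(1,1)$ or $\mathrm{SL}(2,\mathbb{C})$, $\Lambda G_\sigma$ is the group of loops $g:\mathbb{S}^1\to G$ (in a suitable Banach topology) with $g(-\lambda)=\mathrm{Ad}(\mathrm{diag}(1,-1))g(\lambda)$; $\Lambda^+\mathrm{SL}(2,\mathbb{C})_\sigma$ is the subgroup of loops extending holomorphically to the unit disk. Extended frame: $\Phi$ is the solution of $\mathrm{d}\Phi=\Phi\xi$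 with $\Phi(z_0)=\mathrm{Id}$ at a base point $z_0$, and $\Phi=F_\lambda B$ is its Iwasawa decomposition with $F_\lambda\in\Lambda\mathrm{SU}(1,1)_\sigma$, $B\in\Lambda^+\mathrm{SL}(2,\mathbb{C})_\sigma$. The Iwasawa decomposition is not global in general, so the surface is understood locally around the base point $z_0$. $F_{i\lambda}$ is the loop $F_\lambda$ evaluated at $i\lambda$. Surface: with $\sigma_3=\mathrm{diag}(1,-1)$, $X^\lambda=F_\lambda F_{i\lambda}^{-1}$, $Y^\lambda=iF_\lambda\sigma_3F_{i\lambda}^{-1}$, $$\hat{\mathfrak f}^\lambda=\tfrac{1}{\sqrt2}\bigl(\mathrm{Re}X^\lambda_{11}+i\mathrm{Re}Y^\lambda_{11},\ \mathrm{Im}X^\lambda_{11}+i\mathrm{Im}Y^\lambda_{11},\ \mathrm{Re}X^\lambda_{21}+i\mathrm{Re}Y^\lambda_{21},\ \mathrm{Im}X^\lambda_{21}+i\mathrm{Im}Y^\lambda_{21}\bigr)^T$$ (up to a constant phase) and $f^\lambda=[\hat{\mathfrak f}^\lambda]$. The notation $\hat{\mathfrak f}^\lambda(w,\bar w,\lambda)$ means the value at the point $w$; thus the right-hand side of the symmetry formula is evaluated at the point $\bar z$. "The induced metric depends only on $|z|$" means that its conformal factor with respect to $\mathrm{d}z\,\mathrm{d}\bar z$ is a function of $|z|$ only.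
   Formalization: The base point z_0 of the extended frame is taken to be 0, the fixed point of the rotations; for z_0 ≠ 0 the claim fails (for k=0 the metric is a nonconstant function of |z - z_0|, hence not of |z|). *)

theory Defs
  imports "HOL-Analysis.Analysis"
begin

type_synonym mat2 = "complex ^ 2 ^ 2"
type_synonym vec4 = "complex ^ 4"

abbreviation unit_circle :: "complex set" where
  "unit_circle \<equiv> sphere 0 1"

section \<open>Loop groups\<close>

definition sigma3 :: mat2 where
  "sigma3 = vector [vector [1, 0], vector [0, -1]]"

definition SL2C :: "mat2 set" where
  "SL2C = {A. det A = 1}"

definition SU11 :: "mat2 set" where
  "SU11 = {A \<in> SL2C. transpose (map_matrix cnj A) ** sigma3 ** A = sigma3}"

text \<open>
  A loop is a function on the complex plane of which only the values on the unit circle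
  matter. The Banach topology on loops is that of the Wiener algebra: the entries are absolutely
  convergent Fourier series.
\<close>

definition wiener :: "(complex \<Rightarrow> complex) \<Rightarrow> bool" where
  "wiener \<phi> \<longleftrightarrow> (\<exists>a :: int \<Rightarrow> complex. (\<lambda>n. norm (a n)) summable_on UNIV \<and>
     (\<forall>l\<in>unit_circle. ((\<lambda>n. a n * l powi n) has_sum \<phi> l) UNIV))"

definition twisted_loops :: "mat2 set \<Rightarrow> (complex \<Rightarrow> mat2) set" where
  "twisted_loops G = {g. (\<forall>l\<in>unit_circle. g l \<in> G) \<and>
     (\<forall>i j. wiener (\<lambda>l. g l $ i $ j)) \<and>
     (\<forall>l\<in>unit_circle. g (- l) = sigma3 ** g l ** matrix_inv sigma3)}"

definition twisted_plus_loops :: "(complex \<Rightarrow> mat2) set" where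
  "twisted_plus_loops = {g \<in> twisted_loops SL2C. \<forall>i j. \<exists>h.
     continuous_on (cball 0 1) h \<and> h holomorphic_on ball 0 1 \<and>
     (\<forall>l\<in>unit_circle. h l = g l $ i $ j)}"

section \<open>Extended frames\<close>

text \<open>
  Smooth dependence on \<open>z = x + i y\<close> of a map with a parameter \<open>p\<close>: all iterated partial
  derivatives in \<open>x\<close> and \<open>y\<close> exist and are continuous jointly in \<open>(z, p)\<close>.
\<close>

fun Ck_family :: "nat \<Rightarrow> complex set \<Rightarrow> 'p::topological_space set \<Rightarrow>
    (complex \<Rightarrow> 'p \<Rightarrow> 'b::real_normed_vector) \<Rightarrow> bool" where
  "Ck_family 0 U L g \<longleftrightarrow> continuous_on (U \<times> L) (\<lambda>(z, p). g z p)"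
| "Ck_family (Suc n) U L g \<longleftrightarrow> continuous_on (U \<times> L) (\<lambda>(z, p). g z p) \<and>
     (\<exists>gx gy. (\<forall>z\<in>U. \<forall>p\<in>L. ((\<lambda>w. g w p) has_derivative
          (\<lambda>h. Re h *\<^sub>R gx z p + Im h *\<^sub>R gy z p)) (at z)) \<and>
        Ck_family n U L gx \<and> Ck_family n U L gy)"

definition smooth_family :: "complex set \<Rightarrow> 'p::topological_space set \<Rightarrow>
    (complex \<Rightarrow> 'p \<Rightarrow> 'b::real_normed_vector) \<Rightarrow> bool" where
  "smooth_family U L g \<longleftrightarrow> (\<forall>n. Ck_family n U L g)"

text \<open>The case of a one-point parameter space.\<close>

definition smooth_map :: "complex set \<Rightarrow> (complex \<Rightarrow> 'b::real_normed_vector) \<Rightarrow> bool" where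
  "smooth_map U g \<longleftrightarrow> smooth_family U {0::nat} (\<lambda>z p. g z)"

text \<open>The potential as a one-form: its value at the point \<open>z\<close> on the tangent vector \<open>h = dz(h)\<close>.\<close>

definition radial_potential :: "nat \<Rightarrow> complex \<Rightarrow> complex \<Rightarrow> complex \<Rightarrow> complex \<Rightarrow> mat2" where
  "radial_potential k c l z h =
     map_matrix (\<lambda>a. inverse l * a * h) (vector [vector [0, 1], vector [c * z ^ k, 0]])"

text \<open>
  \<open>F z l\<close> is the extended frame at the point \<open>z\<close> and loop parameter \<open>l\<close>, on a domain \<open>U\<close> on which
  the Iwasawa decomposition exists. The base point is \<open>0\<close>. The frame is determined up to
  multiplication from the right by \<open>l\<close>-independent diagonal elements of \<open>SU(1,1)\<close>, which cancel
  in \<open>surface_lift\<close> below, so no normalization of the decomposition is imposed.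
\<close>

definition extended_frame ::
    "nat \<Rightarrow> complex \<Rightarrow> complex set \<Rightarrow> (complex \<Rightarrow> complex \<Rightarrow> mat2) \<Rightarrow> bool" where
  "extended_frame k c U F \<longleftrightarrow>
     smooth_family U unit_circle F \<and>
     (\<exists>\<Phi> B.
        (\<forall>l\<in>unit_circle. \<Phi> 0 l = mat 1 \<and>
           (\<forall>z. ((\<lambda>w. \<Phi> w l) has_derivative
                  (\<lambda>h. \<Phi> z l ** radial_potential k c l z h)) (at z))) \<and>
        (\<forall>z\<in>U. F z \<in> twisted_loops SU11 \<and> B z \<in> twisted_plus_loops \<and>
           (\<forall>l\<in>unit_circle. \<Phi> z l = F z l ** B z l)))"

text \<open>\<open>surface_lift F l z\<close> is the map built from \<open>X\<close> and \<open>Y\<close>, without the constant phase.\<close>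

definition frame_X :: "(complex \<Rightarrow> complex \<Rightarrow> mat2) \<Rightarrow> complex \<Rightarrow> complex \<Rightarrow> mat2" where
  "frame_X F l z = F z l ** matrix_inv (F z (\<i> * l))"

definition frame_Y :: "(complex \<Rightarrow> complex \<Rightarrow> mat2) \<Rightarrow> complex \<Rightarrow> complex \<Rightarrow> mat2" where
  "frame_Y F l z = map_matrix (\<lambda>a. \<i> * a) (F z l ** sigma3 ** matrix_inv (F z (\<i> * l)))"

definition surface_lift :: "(complex \<Rightarrow> complex \<Rightarrow> mat2) \<Rightarrow> complex \<Rightarrow> complex \<Rightarrow> vec4" where
  "surface_lift F l z = (let X = frame_X F l z; Y = frame_Y F l z in
     complex_of_real (1 / sqrt 2) *s vector
       [Complex (Re (X $ 1 $ 1)) (Re (Y $ 1 $ 1)),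
        Complex (Im (X $ 1 $ 1)) (Im (Y $ 1 $ 1)),
        Complex (Re (X $ 2 $ 1)) (Re (Y $ 2 $ 1)),
        Complex (Im (X $ 2 $ 1)) (Im (Y $ 2 $ 1))])"

section \<open>The complex hyperbolic quadric\<close>

definition cnj_vec :: "vec4 \<Rightarrow> vec4" where
  "cnj_vec v = (\<chi> i. cnj (v $ i))"

definition bil :: "vec4 \<Rightarrow> vec4 \<Rightarrow> complex" where
  "bil v w = - v $ 1 * w $ 1 - v $ 2 * w $ 2 + v $ 3 * w $ 3 + v $ 4 * w $ 4"

definition herm :: "vec4 \<Rightarrow> vec4 \<Rightarrow> complex" where
  "herm v w = bil v (cnj_vec w)"

definition H73 :: "vec4 set" where
  "H73 = {v. herm v v = -1}"

text \<open>
  Points of complex projective space are punctured complex lines. In the quotient topology the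
  preimage of a set \<open>S\<close> of points is its union.
\<close>

definition proj :: "vec4 \<Rightarrow> vec4 set" where
  "proj v = {a *s v |a. a \<noteq> 0}"

definition CP3 :: "vec4 set topology" where
  "CP3 = topology (\<lambda>S. S \<subseteq> proj ` (- {0}) \<and> open (\<Union> S))"

definition CH31 :: "vec4 set set" where
  "CH31 = {proj v |v. Re (herm v v) < 0}"

definition Q2star :: "vec4 set set" where
  "Q2star = connected_component_of_set
     (subtopology CP3 {p \<in> CH31. \<forall>v\<in>p. bil v v = 0}) (proj (vector [1, \<i>, 0, 0]))"

lemma proj_cases: "a \<in> proj v \<Longrightarrow> proj a = proj v"
proof -
  assume "a \<in> proj v"
  then obtain s where s: "a = s *s v" "s \<noteq> 0"
    unfolding proj_def by blast
  have "\<exists>r. r \<noteq> 0 \<and> t *s a = r *s v" if "t \<noteq> 0" for t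
    using s that by (intro exI[of _ "t * s"]) (simp add: vector_smult_assoc)
  moreover have "\<exists>r. r \<noteq> 0 \<and> t *s v = r *s a" if "t \<noteq> 0" for t
    using s that by (intro exI[of _ "t / s"]) (simp add: vector_smult_assoc)
  ultimately show ?thesis
    unfolding proj_def by blast
qed

lemma openin_CP3: "openin CP3 S \<longleftrightarrow> S \<subseteq> proj ` (- {0}) \<and> open (\<Union> S)"
proof -
  have "istopology (\<lambda>S. S \<subseteq> proj ` (- {0}) \<and> open (\<Union> S))"
    unfolding istopology_def
  proof (intro conjI allI impI)
    fix S T
    assume S: "S \<subseteq> proj ` (- {0}) \<and> open (\<Union> S)" and T: "T \<subseteq> proj ` (- {0}) \<and> open (\<Union> T)"
    have "\<Union> S \<inter> \<Union> T \<subseteq> \<Union> (S \<inter> T)"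
    proof
      fix a assume "a \<in> \<Union> S \<inter> \<Union> T"
      then obtain p q where pq: "p \<in> S" "a \<in> p" "q \<in> T" "a \<in> q" by blast
      then obtain v w where "p = proj v" "q = proj w" using S T by blast
      with pq have "p = q" using proj_cases by metis
      with pq show "a \<in> \<Union> (S \<inter> T)" by blast
    qed
    then have "\<Union> (S \<inter> T) = \<Union> S \<inter> \<Union> T" by blast
    then show "open (\<Union> (S \<inter> T))" using S T by (simp add: open_Int)
    show "S \<inter> T \<subseteq> proj ` (- {0})" using S by blast
  next
    fix K assume K: "\<forall>S\<in>K. S \<subseteq> proj ` (- {0}) \<and> open (\<Union> S)"
    then show "\<Union> K \<subseteq> proj ` (- {0})" by blast
    have "\<Union> (\<Union> K) = (\<Union>S\<in>K. \<Union> S)" by blast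
    then show "open (\<Union> (\<Union> K))" using K by auto
  qed
  then show ?thesis
    unfolding CP3_def by (simp add: topology_inverse')
qed

section \<open>Surfaces and their horizontal lifts\<close>

definition deriv_dir :: "(complex \<Rightarrow> vec4) \<Rightarrow> complex \<Rightarrow> complex \<Rightarrow> vec4" where
  "deriv_dir \<ff> z h = frechet_derivative \<ff> (at z) h"

abbreviation deriv_x :: "(complex \<Rightarrow> vec4) \<Rightarrow> complex \<Rightarrow> vec4" where
  "deriv_x \<ff> z \<equiv> deriv_dir \<ff> z 1"

abbreviation deriv_y :: "(complex \<Rightarrow> vec4) \<Rightarrow> complex \<Rightarrow> vec4" where
  "deriv_y \<ff> z \<equiv> deriv_dir \<ff> z \<i>"

definition wirtinger_z :: "(complex \<Rightarrow> vec4) \<Rightarrow> complex \<Rightarrow> vec4" where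
  "wirtinger_z \<ff> z = (1/2) *s (deriv_x \<ff> z - \<i> *s deriv_y \<ff> z)"

definition wirtinger_zbar :: "(complex \<Rightarrow> vec4) \<Rightarrow> complex \<Rightarrow> vec4" where
  "wirtinger_zbar \<ff> z = (1/2) *s (deriv_x \<ff> z + \<i> *s deriv_y \<ff> z)"

definition is_lift :: "complex set \<Rightarrow> (complex \<Rightarrow> vec4 set) \<Rightarrow> (complex \<Rightarrow> vec4) \<Rightarrow> bool" where
  "is_lift U f \<ff> \<longleftrightarrow> smooth_map U \<ff> \<and> (\<forall>z\<in>U. \<ff> z \<in> H73 \<and> f z = proj (\<ff> z))"

definition horizontal_lift :: "complex set \<Rightarrow> (complex \<Rightarrow> vec4 set) \<Rightarrow> (complex \<Rightarrow> vec4) \<Rightarrow> bool" where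
  "horizontal_lift U f \<ff> \<longleftrightarrow> is_lift U f \<ff> \<and>
     (\<forall>z\<in>U. bil (wirtinger_z \<ff> z) (cnj_vec (\<ff> z)) = 0 \<and>
             bil (wirtinger_zbar \<ff> z) (cnj_vec (\<ff> z)) = 0)"

text \<open>
  The Hopf fibration is a pseudo-Riemannian submersion, so the metric and the Kaehler form of
  complex hyperbolic space are those of \<^term>\<open>herm\<close> on horizontal parts. At a point \<open>p\<close> with
  \<open>herm p p = -1\<close>, the horizontal part of \<open>v\<close> is \<open>v + herm v p p\<close>. Hence the two notions below
  depend on the surface \<open>proj \<circ> \<ff>\<close> only, not on the lift \<open>\<ff>\<close>.
\<close>

definition horizontal_part :: "vec4 \<Rightarrow> vec4 \<Rightarrow> vec4" where
  "horizontal_part p v = v + herm v p *s p"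

definition induced_metric :: "(complex \<Rightarrow> vec4) \<Rightarrow> complex \<Rightarrow> complex \<Rightarrow> complex \<Rightarrow> real" where
  "induced_metric \<ff> z v w = Re (herm (horizontal_part (\<ff> z) (deriv_dir \<ff> z v))
                                     (horizontal_part (\<ff> z) (deriv_dir \<ff> z w)))"

definition induced_kaehler_form :: "(complex \<Rightarrow> vec4) \<Rightarrow> complex \<Rightarrow> complex \<Rightarrow> complex \<Rightarrow> real" where
  "induced_kaehler_form \<ff> z v w = Re (herm (\<i> *s horizontal_part (\<ff> z) (deriv_dir \<ff> z v))
                                           (horizontal_part (\<ff> z) (deriv_dir \<ff> z w)))"

text \<open>
  For a horizontal lift \<open>\<ff>\<close>, the horizontal lift of the Levi-Civita derivative in \<open>Q2star\<close> of the
  differential of \<open>f\<close> is obtained from the second derivatives of \<open>\<ff>\<close> in the flat space by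
  orthogonal projection along \<open>\<ff>\<close> and its conjugate \<open>\<ff>'\<close> (over the complex numbers); the latter
  spans the normal space of \<open>Q2star\<close>. So the trace of the second fundamental form is the class
  of \<open>\<Sum> g\<^sup>i\<^sup>j \<ff>\<^sub>i\<^sub>j\<close> modulo the complex span of \<open>\<ff>\<close>, \<open>\<ff>'\<close> and the real span of \<open>\<ff>\<^sub>x\<close>, \<open>\<ff>\<^sub>y\<close>.
  Below, the trace is multiplied by the determinant of the metric \<open>g\<close>.
\<close>

definition mean_curvature_vanishes :: "(complex \<Rightarrow> vec4) \<Rightarrow> complex \<Rightarrow> bool" where
  "mean_curvature_vanishes \<ff> z \<longleftrightarrow>
     (\<exists>(a::complex) (b::complex) (s::real) (t::real).
        induced_metric \<ff> z \<i> \<i> *\<^sub>R deriv_x (deriv_x \<ff>) z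
        - (2 * induced_metric \<ff> z 1 \<i>) *\<^sub>R deriv_x (deriv_y \<ff>) z
        + induced_metric \<ff> z 1 1 *\<^sub>R deriv_y (deriv_y \<ff>) z
        = a *s \<ff> z + b *s cnj_vec (\<ff> z) + s *\<^sub>R deriv_x \<ff> z + t *\<^sub>R deriv_y \<ff> z)"

text \<open>
  The metric of \<open>Q2star\<close> is positive definite, so immersions are the maps with positive
  definite induced metric.
\<close>

definition minimal_lagrangian_Q2star ::
    "complex set \<Rightarrow> (complex \<Rightarrow> vec4 set) \<Rightarrow> (complex \<Rightarrow> vec4) \<Rightarrow> bool" where
  "minimal_lagrangian_Q2star U f \<ff> \<longleftrightarrow>
     horizontal_lift U f \<ff> \<and>
     (\<forall>z\<in>U. f z \<in> Q2star \<and>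
        (\<forall>v. v \<noteq> 0 \<longrightarrow> induced_metric \<ff> z v v > 0) \<and>
        (\<forall>v w. induced_kaehler_form \<ff> z v w = 0) \<and>
        mean_curvature_vanishes \<ff> z)"

section \<open>Symmetries\<close>

definition reflection :: "nat \<Rightarrow> nat \<Rightarrow> complex \<Rightarrow> complex" where
  "reflection k m z = exp (2 * of_real pi * \<i> * of_nat m / of_nat (k + 2)) * cnj z"

definition symmetry_matrix :: "nat \<Rightarrow> nat \<Rightarrow> complex ^ 4 ^ 4" where
  "symmetry_matrix k m = (let t = 2 * pi * real m / real (k + 2) in
     map_matrix complex_of_real (vector
       [vector [1, 0, 0, 0],
        vector [0, 1, 0, 0],
        vector [0, 0, cos t, sin t],
        vector [0, 0, - sin t, cos t]]))"

end

theory Submission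
  imports Defs "HOL-Complex_Analysis.Conformal_Mappings"
begin

text \<open>
  Write \<open>b\<close> for the upper left entry at \<open>l = 0\<close> of the holomorphic Iwasawa factor, which is diagonal
  there. A function of \<open>l\<close> that extends holomorphically both inside and outside the circle is
  constant (Liouville), so the Maurer--Cartan form of the frame \<open>F\<close> is determined by its terms of
  degree \<open>-1\<close> and \<open>0\<close> in \<open>l\<close>: the first has the entries \<open>\<beta> = b\<^sup>2\<close> and \<open>\<gamma> = c z\<^sup>k / b\<^sup>2\<close>, the second
  is given by the logarithmic \<open>z\<close>-bar-derivative of \<open>b\<close>. The lift of the surface is the tensor
  product of the second column of \<open>F\<close> at \<open>l\<close> and the first column at \<open>\<i> l\<close>; differentiating it shows that it is
  horizontal, Lagrangian and conformal with metric \<open>2 (\<bar>\<beta>\<bar>\<^sup>2 + \<bar>\<gamma>\<bar>\<^sup>2) dz dz\<close>-bar, and that its Laplacian lies in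
  the span of the lift and its conjugate. Rotating \<open>z\<close> by \<open>\<theta>\<close> changes the solution \<open>\<Phi>\<close> only by the
  rotation of \<open>l\<close> by \<open>- (k + 2) \<theta> / 2\<close> and a constant diagonal gauge. By uniqueness of the Iwasawa
  decomposition \<open>\<bar>b\<bar>\<close> is radial, and for \<open>\<theta> = 2 \<pi> m / (k + 2)\<close> the new loop parameter is
  \<open>(- 1)\<^sup>m l\<close>, where the twisting of \<open>F\<close> gives the symmetry.
\<close>

section \<open>The disk algebra\<close>

text \<open>Members are total functions with unconstrained values outside the closed disk, so
  agreement on the circle determines a member on \<open>cball 0 1\<close> only.\<close>

definition disk_algebra :: "(complex \<Rightarrow> complex) set" where
  "disk_algebra = {h. continuous_on (cball 0 1) h \<and> h holomorphic_on ball 0 1}"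

lemma disk_algebra_const [intro]: "(\<lambda>l. a) \<in> disk_algebra"
  and disk_algebra_id [intro]: "(\<lambda>l. l) \<in> disk_algebra"
  by (simp_all add: disk_algebra_def)

lemma disk_algebra_add [intro]:
  "g \<in> disk_algebra \<Longrightarrow> h \<in> disk_algebra \<Longrightarrow> (\<lambda>l. g l + h l) \<in> disk_algebra"
  and disk_algebra_diff [intro]:
  "g \<in> disk_algebra \<Longrightarrow> h \<in> disk_algebra \<Longrightarrow> (\<lambda>l. g l - h l) \<in> disk_algebra"
  and disk_algebra_mult [intro]:
  "g \<in> disk_algebra \<Longrightarrow> h \<in> disk_algebra \<Longrightarrow> (\<lambda>l. g l * h l) \<in> disk_algebra"
  and disk_algebra_minus [intro]:
  "g \<in> disk_algebra \<Longrightarrow> (\<lambda>l. - g l) \<in> disk_algebra"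
  and disk_algebra_exp:
  "g \<in> disk_algebra \<Longrightarrow> (\<lambda>l. exp (g l)) \<in> disk_algebra"
  by (auto simp: disk_algebra_def intro!: continuous_intros holomorphic_intros)

lemma disk_algebra_rotate:
  assumes "h \<in> disk_algebra" "norm \<zeta> = 1"
  shows "(\<lambda>l. h (\<zeta> * l)) \<in> disk_algebra"
proof -
  have c: "continuous_on (cball 0 1) h" and h: "h holomorphic_on ball 0 1"
    using assms(1) by (simp_all add: disk_algebra_def)
  have "continuous_on (cball 0 1) (\<lambda>l. h (\<zeta> * l))"
    by (rule continuous_on_compose2[OF c]) (auto intro!: continuous_intros simp: norm_mult assms(2))
  moreover have "(h \<circ> (\<lambda>l. \<zeta> * l)) holomorphic_on ball 0 1"
    by (rule holomorphic_on_compose_gen[OF _ h]) (auto intro!: holomorphic_intros simp: norm_mult assms(2))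
  ultimately show ?thesis by (simp add: disk_algebra_def o_def)
qed

text \<open>The maximum modulus principle, through which estimates on the circle pass to the
  disk.\<close>

lemma disk_algebra_bound:
  assumes "h \<in> disk_algebra" "\<And>l. l \<in> unit_circle \<Longrightarrow> norm (h l) \<le> M" "l \<in> cball 0 1"
  shows "norm (h l) \<le> M"
  using assms by (intro maximum_modulus_frontier[of h "cball 0 1" M l]) (auto simp: disk_algebra_def)

lemma disk_algebra_eqI:
  assumes "g \<in> disk_algebra" "h \<in> disk_algebra" "\<And>l. l \<in> unit_circle \<Longrightarrow> g l = h l" "l \<in> cball 0 1"
  shows "g l = h l"
  using disk_algebra_bound[of "\<lambda>l. g l - h l" 0 l] assms by auto

text \<open>On the circle \<open>exp (\<i> * h l)\<close> and its inverse have modulus 1, so both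
  have modulus at most 1 in the disk, which forces \<open>Im (h l) = 0\<close> there. A real-valued
  holomorphic function is not open, hence constant, and continuity reaches the circle.\<close>

lemma disk_algebra_real_imp_const:
  assumes h: "h \<in> disk_algebra" and real: "\<And>l. l \<in> unit_circle \<Longrightarrow> h l \<in> \<real>" and l: "l \<in> cball 0 1"
  shows "h l = h 0"
proof -
  have e1: "norm (exp (\<i> * h \<mu>)) \<le> 1" and e2: "norm (exp (- (\<i> * h \<mu>))) \<le> 1" if "\<mu> \<in> cball 0 1" for \<mu>
  proof -
    have "(\<lambda>l. exp (\<i> * h l)) \<in> disk_algebra" "(\<lambda>l. exp (- (\<i> * h l))) \<in> disk_algebra"
      by (intro disk_algebra_exp disk_algebra_minus disk_algebra_mult disk_algebra_const h)+
    then show "norm (exp (\<i> * h \<mu>)) \<le> 1" "norm (exp (- (\<i> * h \<mu>))) \<le> 1"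
      using real that by (auto intro: disk_algebra_bound[of "\<lambda>l. exp (\<i> * h l)" 1 \<mu>, simplified]
        disk_algebra_bound[of "\<lambda>l. exp (- (\<i> * h l))" 1 \<mu>, simplified] simp: complex_is_Real_iff)
  qed
  have im: "Im (h \<mu>) = 0" if "\<mu> \<in> cball 0 1" for \<mu>
    using e1[OF that] e2[OF that] by simp
  have "h constant_on ball 0 1"
  proof (rule ccontr)
    assume "\<not> h constant_on ball 0 1"
    then have "open (h ` ball 0 1)"
      using h by (intro open_mapping_thm[of h "ball 0 1"]) (auto simp: disk_algebra_def)
    then obtain e where e: "e > 0" "ball (h 0) e \<subseteq> h ` ball 0 1"
      by (force simp: open_contains_ball)
    have "h 0 + \<i> * of_real (e / 2) \<in> ball (h 0) e"
      using e by (simp add: dist_norm norm_mult)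
    then obtain \<mu> where "\<mu> \<in> ball 0 1" "h 0 + \<i> * of_real (e / 2) = h \<mu>" using e by blast
    then show False using im[of \<mu>] im[of 0] e(1) by (auto simp: complex_eq_iff)
  qed
  then obtain a where a: "\<And>\<mu>. \<mu> \<in> ball 0 1 \<Longrightarrow> h \<mu> = a" by (auto simp: constant_on_def)
  then show ?thesis
    using continuous_constant_on_closure[of "ball 0 1" h a l] h l
    by (simp add: disk_algebra_def)
qed

text \<open>The form of Liouville's theorem used throughout: \<open>h + g\<close> and
  \<open>\<i> * (h - g)\<close> are real on the circle, hence constant, and together they determine
  \<open>h\<close>.\<close>

lemma disk_algebra_conj_imp_const:
  assumes h: "h \<in> disk_algebra" and g: "g \<in> disk_algebra"
    and eq: "\<And>l. l \<in> unit_circle \<Longrightarrow> h l = cnj (g l)" and l: "l \<in> cball 0 1"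
  shows "h l = h 0"
proof -
  have "h l + g l = h 0 + g 0"
    using h g l eq by (intro disk_algebra_real_imp_const[of "\<lambda>l. h l + g l"])
      (auto simp: complex_is_Real_iff)
  moreover have "\<i> * (h l - g l) = \<i> * (h 0 - g 0)"
    using h g l eq by (intro disk_algebra_real_imp_const[of "\<lambda>l. \<i> * (h l - g l)"])
      (auto simp: complex_is_Real_iff)
  ultimately show ?thesis by (simp add: complex_eq_iff)
qed

text \<open>The removable singularity of the quotient is filled with \<open>deriv h 0\<close>; away
  from 0, and so on the boundary, the quotient is continuous as it stands.\<close>

lemma disk_algebra_divide:
  assumes "h \<in> disk_algebra" "h 0 = 0"
  obtains v where "v \<in> disk_algebra" "\<And>l. h l = l * v l"
proof
  let ?v = "\<lambda>l. if l = 0 then deriv h 0 else (h l - h 0) / (l - 0)"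
  have hol: "?v holomorphic_on ball 0 1"
    using assms by (intro pole_lemma) (auto simp: disk_algebra_def)
  have "continuous (at l within cball 0 1) ?v" if "l \<in> cball 0 1" for l
  proof (cases "l \<in> ball 0 1")
    case True
    then have "isCont ?v l"
      using hol holomorphic_on_imp_continuous_on continuous_on_eq_continuous_at by blast
    then show ?thesis using continuous_at_imp_continuous_at_within by blast
  next
    case False
    then have l0: "l \<noteq> 0" by auto
    have *: "continuous (at l within cball 0 1) (\<lambda>l. h l / l)"
      using assms that l0
      by (intro continuous_intros) (auto simp: disk_algebra_def continuous_on_eq_continuous_within)
    show ?thesis
      by (rule continuous_transform_within[OF *, of 1]) 
        (use assms that False l0 in \<open>auto simp: dist_norm\<close>)
  qed
  then show "?v \<in> disk_algebra"
    using hol by (simp add: disk_algebra_def continuous_on_eq_continuous_within)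
  show "h l = l * ?v l" for l using assms by auto
qed

text \<open>In Fourier terms \<open>h\<close> has only nonnegative degrees and
  \<open>l * cnj (g l)\<close> only degrees at most 1, so just the degrees 0 and 1 survive. The
  proof strips the constant term, divides by \<open>l\<close> and applies
  \<open>disk_algebra_conj_imp_const\<close> in both directions.\<close>

lemma disk_algebra_linear:
  assumes h: "h \<in> disk_algebra" and g: "g \<in> disk_algebra"
    and eq: "\<And>l. l \<in> unit_circle \<Longrightarrow> h l = l * cnj (g l)" and l: "l \<in> unit_circle"
  shows "h l = h 0 + l * cnj (g 0)"
proof -
  obtain v where v: "v \<in> disk_algebra" "\<And>l. h l - h 0 = l * v l"
    using disk_algebra_divide[OF disk_algebra_diff[OF h disk_algebra_const]] by (metis diff_self)
  have circle: "l * cnj l = 1" if "l \<in> unit_circle" for l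
    using that by (simp flip: complex_norm_square)
  \<comment> \<open>On the circle \<open>1 / l = cnj l\<close>, which moves the subtracted constant
    under the conjugation.\<close>
  have *: "v l = cnj (g l - cnj (h 0) * l)" if "l \<in> unit_circle" for l
  proof -
    have "l * v l = l * cnj (g l) - (l * cnj l) * h 0"
      using v(2)[of l] eq[OF that] circle[OF that] by simp
    also have "\<dots> = l * cnj (g l - cnj (h 0) * l)" by (simp add: algebra_simps)
    finally show ?thesis using that by (metis dist_0_norm mem_sphere mult_cancel_left norm_zero zero_neq_one)
  qed
  have lin: "(\<lambda>l. g l - cnj (h 0) * l) \<in> disk_algebra"
    by (intro disk_algebra_diff disk_algebra_mult disk_algebra_const disk_algebra_id g)
  have "v l = v 0"
    by (rule disk_algebra_conj_imp_const[OF v(1) lin *]) (use l in auto)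
  moreover have "g l - cnj (h 0) * l = g 0 - cnj (h 0) * 0"
    by (rule disk_algebra_conj_imp_const[OF lin v(1)]) (use l * in auto)
  ultimately have "v 0 = cnj (g 0)" using *[OF l] by simp
  then show ?thesis using v(2)[of l] \<open>v l = v 0\<close> by (simp add: algebra_simps)
qed

section \<open>Parameter derivatives of functions in the disk algebra\<close>

lemma has_vector_derivative_complex_iff:
  fixes g :: "real \<Rightarrow> complex"
  shows "(g has_vector_derivative D) (at 0) \<longleftrightarrow> ((\<lambda>t. (g t - g 0) / of_real t) \<longlongrightarrow> D) (at 0)"
proof -
  have "(g has_vector_derivative D) (at 0) \<longleftrightarrow>
      ((\<lambda>t. norm (g t - g 0 - t *\<^sub>R D) / norm t) \<longlongrightarrow> 0) (at 0)"
    by (simp add: has_vector_derivative_def has_derivative_at bounded_linear_scaleR_left)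
  also have "\<dots> \<longleftrightarrow> ((\<lambda>t. norm ((g t - g 0) / of_real t - D)) \<longlongrightarrow> 0) (at 0)"
  proof (rule Lim_cong_within)
    fix t :: real assume "t \<noteq> 0"
    then have "(g t - g 0) / of_real t - D = (g t - g 0 - t *\<^sub>R D) / of_real t"
      by (simp add: field_simps scaleR_conv_of_real)
    then show "norm (g t - g 0 - t *\<^sub>R D) / norm t = norm ((g t - g 0) / of_real t - D)"
      by (simp only: norm_divide norm_of_real real_norm_def)
  qed auto
  finally show ?thesis by (simp add: tendsto_norm_zero_iff LIM_zero_iff)
qed

text \<open>Differentiability is given on the circle only. Continuity of \<open>g'\<close> on a
  compact set makes the difference quotients converge uniformly there, the maximum modulus principle
  spreads the Cauchy estimate over the disk, and the uniform limit supplies both the extension of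
  \<open>g' 0\<close> and the derivative at the centre \<open>l = 0\<close>.\<close>

lemma disk_algebra_derivative:
  fixes g g' :: "real \<Rightarrow> complex \<Rightarrow> complex"
  assumes \<delta>: "\<delta> > 0"
    and g: "\<And>t. \<bar>t\<bar> \<le> \<delta> \<Longrightarrow> g t \<in> disk_algebra"
    and deriv: "\<And>t l. \<bar>t\<bar> \<le> \<delta> \<Longrightarrow> l \<in> unit_circle \<Longrightarrow> ((\<lambda>s. g s l) has_vector_derivative g' t l) (at t)"
    and cont: "continuous_on ({-\<delta>..\<delta>} \<times> unit_circle) (\<lambda>(t, l). g' t l)"
  obtains h where "h \<in> disk_algebra" "\<And>l. l \<in> unit_circle \<Longrightarrow> h l = g' 0 l"
    "((\<lambda>t. g t 0) has_vector_derivative h 0) (at 0)"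
proof -
  define q where "q t l = (g t l - g 0 l) / of_real t" for t l
  have q: "q t \<in> disk_algebra" if "\<bar>t\<bar> \<le> \<delta>" for t
    unfolding q_def divide_inverse using g[OF that] g[of 0] \<delta> by auto
  have ex: "\<exists>d>0. d \<le> \<delta> \<and> (\<forall>t. t \<noteq> 0 \<and> \<bar>t\<bar> < d \<longrightarrow> (\<forall>l\<in>unit_circle. norm (q t l - g' 0 l) \<le> e))"
    if "e > 0" for e
  proof -
    have "uniformly_continuous_on ({-\<delta>..\<delta>} \<times> unit_circle) (\<lambda>(t, l). g' t l)"
      by (intro compact_uniformly_continuous cont compact_Times) auto
    then obtain d where d: "d > 0" "\<And>x y. x \<in> {-\<delta>..\<delta>} \<times> unit_circle \<Longrightarrow> y \<in> {-\<delta>..\<delta>} \<times> unit_circle \<Longrightarrow>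
        dist y x < d \<Longrightarrow> dist (case y of (t, l) \<Rightarrow> g' t l) (case x of (t, l) \<Rightarrow> g' t l) < e"
      using \<open>e > 0\<close> unfolding uniformly_continuous_on_def by meson
    have near: "norm (g' t l - g' 0 l) \<le> e" if "\<bar>t\<bar> < min d \<delta>" "l \<in> unit_circle" for t l
      using d(2)[of "(0, l)" "(t, l)"] that by (simp add: dist_norm dist_Pair_Pair abs_less_iff)
    have "norm (q t l - g' 0 l) \<le> e" if t: "t \<noteq> 0" "\<bar>t\<bar> < min d \<delta>" and l: "l \<in> unit_circle" for t l
    proof -
      \<comment> \<open>The mean value inequality turns the bound on the variation of
        \<open>g'\<close> into one on the difference quotient.\<close>
      have "norm (g t l - g 0 l - (t - 0) *\<^sub>R g' 0 l) \<le> norm (t - 0) * e"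
      proof (rule vector_differentiable_bound_linearization[where S = "{-\<bar>t\<bar>..\<bar>t\<bar>}"])
        fix x assume "x \<in> {-\<bar>t\<bar>..\<bar>t\<bar>}"
        then have x: "\<bar>x\<bar> < min d \<delta>" using t by auto
        show "((\<lambda>s. g s l) has_vector_derivative g' x l) (at x within {-\<bar>t\<bar>..\<bar>t\<bar>})"
          by (rule has_vector_derivative_at_within, rule deriv) (use x l in auto)
        show "norm (g' x l - g' 0 l) \<le> e" using near x l by blast
      qed (auto simp: closed_segment_eq_real_ivl)
      then have "norm ((g t l - g 0 l - of_real t * g' 0 l) / of_real t) \<le> e"
        using t by (simp add: norm_divide field_simps scaleR_conv_of_real)
      then show ?thesis using t by (simp add: q_def diff_divide_distrib)
    qed
    then show ?thesis using d(1) \<delta> by (intro exI[of _ "min d \<delta>"]) auto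
  qed
  have cauchy: "norm (q t l - q s l) \<le> 2 * e"
    if d: "d \<le> \<delta>" "\<forall>t. t \<noteq> 0 \<and> \<bar>t\<bar> < d \<longrightarrow> (\<forall>l\<in>unit_circle. norm (q t l - g' 0 l) \<le> e)"
      and ts: "t \<noteq> 0" "\<bar>t\<bar> < d" "s \<noteq> 0" "\<bar>s\<bar> < d" and l: "l \<in> cball 0 1" for d e t s l
  proof (rule disk_algebra_bound[OF disk_algebra_diff[OF q q] _ l])
    fix l :: complex assume "l \<in> unit_circle"
    then have "norm (q t l - g' 0 l) \<le> e" "norm (q s l - g' 0 l) \<le> e" using d ts by auto
    then show "norm (q t l - q s l) \<le> 2 * e"
      using norm_triangle_ineq4[of "q t l - g' 0 l" "q s l - g' 0 l"] by simp
  qed (use d ts in auto)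
  \<comment> \<open>A sequence of nonzero parameters tending to 0, along which the uniform limit is
    taken.\<close>
  define s where "s n = \<delta> / (real n + 2)" for n
  have s: "s n \<noteq> 0" "\<bar>s n\<bar> \<le> \<delta>" for n using \<delta> by (auto simp: s_def field_simps)
  have s0: "s \<longlonglongrightarrow> 0" 
    unfolding s_def using LIMSEQ_ignore_initial_segment[OF lim_const_over_n[of \<delta>], of 2] by (simp add: add.commute)
  have ev: "\<forall>\<^sub>F n in sequentially. \<bar>s n\<bar> < d" if "d > 0" for d
    using s0 that by (auto simp: tendsto_iff dist_norm)
  have "uniformly_Cauchy_on (cball 0 1) (\<lambda>n. q (s n))"
  proof (rule uniformly_Cauchy_onI)
    fix e :: real assume "e > 0"
    then obtain d where d: "d > 0" "d \<le> \<delta>"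
      "\<forall>t. t \<noteq> 0 \<and> \<bar>t\<bar> < d \<longrightarrow> (\<forall>l\<in>unit_circle. norm (q t l - g' 0 l) \<le> e / 3)"
      using ex[of "e / 3"] by auto
    obtain N where N: "\<And>n. n \<ge> N \<Longrightarrow> \<bar>s n\<bar> < d"
      using ev[OF d(1)] by (auto simp: eventually_at_top_linorder)
    have "dist (q (s m) l) (q (s n) l) < e" if "l \<in> cball 0 1" "m \<ge> N" "n \<ge> N" for l m n
      using cauchy[OF d(2,3) s(1) N[OF that(2)] s(1) N[OF that(3)] that(1)] \<open>e > 0\<close>
      by (simp add: dist_norm)
    then show "\<exists>M. \<forall>x\<in>cball 0 1. \<forall>m\<ge>M. \<forall>n\<ge>M. dist (q (s m) x) (q (s n) x) < e" by blast
  qed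
  then obtain h where h: "uniform_limit (cball 0 1) (\<lambda>n. q (s n)) h sequentially"
    by (auto simp flip: uniformly_convergent_eq_Cauchy simp: uniformly_convergent_on_def)
  have lim: "(\<lambda>n. q (s n) l) \<longlonglongrightarrow> h l" if "l \<in> cball 0 1" for l
    using tendsto_uniform_limitI[OF h that] .
  have "h \<in> disk_algebra"
  proof (rule holomorphic_uniform_limit[OF _ h])
    show "\<forall>\<^sub>F n in sequentially. continuous_on (cball 0 1) (q (s n)) \<and> q (s n) holomorphic_on ball 0 1"
      using q[OF s(2)] by (simp add: disk_algebra_def)
  qed (auto simp: disk_algebra_def)
  moreover have "h l = g' 0 l" if l: "l \<in> unit_circle" for l
  proof -
    have "((\<lambda>t. q t l) \<longlongrightarrow> g' 0 l) (at 0)"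
      using deriv[of 0 l] \<delta> l by (simp add: q_def has_vector_derivative_complex_iff)
    then have "(\<lambda>n. q (s n) l) \<longlonglongrightarrow> g' 0 l"
      using s0 s(1) by (intro filterlim_compose[of "\<lambda>t. q t l" _ "at 0" s]) (auto simp: filterlim_at)
    moreover have "(\<lambda>n. q (s n) l) \<longlonglongrightarrow> h l" using lim[of l] l by simp
    ultimately show ?thesis by (rule LIMSEQ_unique[symmetric])
  qed
  moreover have "((\<lambda>t. g t 0) has_vector_derivative h 0) (at 0)"
  proof -
    \<comment> \<open>Convergence along all \<open>t\<close>, not just along \<open>s\<close>:
      \<open>cauchy\<close> compares \<open>q t\<close> with \<open>q (s n)\<close> at the centre,
      and then \<open>n\<close> tends to infinity.\<close>
    have "((\<lambda>t. q t 0) \<longlongrightarrow> h 0) (at 0)"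
    proof (rule tendstoI)
      fix e :: real assume "e > 0"
      then obtain d where d: "d > 0" "d \<le> \<delta>"
        "\<forall>t. t \<noteq> 0 \<and> \<bar>t\<bar> < d \<longrightarrow> (\<forall>l\<in>unit_circle. norm (q t l - g' 0 l) \<le> e / 3)"
        using ex[of "e / 3"] by auto
      have "dist (q t 0) (h 0) < e" if t: "t \<noteq> 0" "\<bar>t\<bar> < d" for t
      proof -
        have "\<forall>\<^sub>F n in sequentially. norm (q t 0 - q (s n) 0) \<le> 2 * (e / 3)"
        proof (rule eventually_mono[OF ev[OF d(1)]])
          show "norm (q t 0 - q (s n) 0) \<le> 2 * (e / 3)" if "\<bar>s n\<bar> < d" for n
            using cauchy[OF d(2,3) t s(1) that, of 0] by simp
        qed
        moreover have "(\<lambda>n. norm (q t 0 - q (s n) 0)) \<longlonglongrightarrow> norm (q t 0 - h 0)"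
          using lim[of 0] by (intro tendsto_intros) auto
        ultimately have "norm (q t 0 - h 0) \<le> 2 * (e / 3)"
          by (intro tendsto_upperbound[of "\<lambda>n. norm (q t 0 - q (s n) 0)" _ sequentially]) auto
        then show ?thesis using \<open>e > 0\<close> by (simp add: dist_norm)
      qed
      then show "\<forall>\<^sub>F t in at 0. dist (q t 0) (h 0) < e"
        unfolding eventually_at using d(1) by (auto simp: dist_norm)
    qed
    then show ?thesis by (simp add: q_def has_vector_derivative_complex_iff)
  qed
  ultimately show ?thesis using that by blast
qed

section \<open>Matrices\<close>

lemma vector_4 [simp]:
  fixes a b c d :: "'a::zero"
  shows "(vector [a, b, c, d] :: 'a ^ 4) $ 1 = a" "(vector [a, b, c, d] :: 'a ^ 4) $ 2 = b"
    "(vector [a, b, c, d] :: 'a ^ 4) $ 3 = c" "(vector [a, b, c, d] :: 'a ^ 4) $ 4 = d"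
  unfolding vector_def by simp_all

lemma mat2_eq_iff:
  "(A :: mat2) = B \<longleftrightarrow> A $ 1 $ 1 = B $ 1 $ 1 \<and> A $ 1 $ 2 = B $ 1 $ 2 \<and> A $ 2 $ 1 = B $ 2 $ 1 \<and> A $ 2 $ 2 = B $ 2 $ 2"
  by (simp add: vec_eq_iff forall_2)

lemma mat2_mult_nth: "((A :: mat2) ** B) $ i $ j = A $ i $ 1 * B $ 1 $ j + A $ i $ 2 * B $ 2 $ j"
  by (simp add: matrix_matrix_mult_def sum_2)

lemma mat2_one_nth [simp]: "(mat 1 :: mat2) $ 1 $ 1 = 1" "(mat 1 :: mat2) $ 1 $ 2 = 0"
  "(mat 1 :: mat2) $ 2 $ 1 = 0" "(mat 1 :: mat2) $ 2 $ 2 = 1"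
  by (simp_all add: mat_def)

lemma bounded_bilinear_mat2_mult: "bounded_bilinear ((**) :: mat2 \<Rightarrow> mat2 \<Rightarrow> mat2)"
  unfolding bilinear_conv_bounded_bilinear[symmetric] bilinear_def
  by (auto intro!: linearI simp: mat2_eq_iff mat2_mult_nth algebra_simps)

text \<open>The adjugate: it is the inverse when the determinant is 1 and, unlike the inverse,
  linear in \<open>A\<close>, so it can be differentiated directly.\<close>

definition adj2 :: "mat2 \<Rightarrow> mat2" where
  "adj2 A = vector [vector [A $ 2 $ 2, - A $ 1 $ 2], vector [- A $ 2 $ 1, A $ 1 $ 1]]"

lemma adj2_nth [simp]: "adj2 A $ 1 $ 1 = A $ 2 $ 2" "adj2 A $ 1 $ 2 = - A $ 1 $ 2"
  "adj2 A $ 2 $ 1 = - A $ 2 $ 1" "adj2 A $ 2 $ 2 = A $ 1 $ 1"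
  by (simp_all add: adj2_def)

lemma bounded_linear_adj2: "bounded_linear adj2"
  unfolding linear_conv_bounded_linear[symmetric] by (auto intro!: linearI simp: mat2_eq_iff)

lemma adj2_mult_left: "det A = 1 \<Longrightarrow> adj2 A ** A = mat 1"
  and adj2_mult_right: "det A = 1 \<Longrightarrow> A ** adj2 A = mat 1"
  by (simp_all add: mat2_eq_iff mat2_mult_nth det_2 algebra_simps)

lemma matrix_inv_eqI: "A ** B = mat 1 \<Longrightarrow> B ** A = mat 1 \<Longrightarrow> matrix_inv A = (B :: mat2)"
  unfolding matrix_inv_def
  by (rule some_equality, blast) (metis matrix_mul_assoc matrix_mul_lid matrix_mul_rid)

lemma matrix_inv_det_1: "det (A :: mat2) = 1 \<Longrightarrow> matrix_inv A = adj2 A"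
  by (intro matrix_inv_eqI adj2_mult_left adj2_mult_right)

lemma sigma3_nth [simp]: "sigma3 $ 1 $ 1 = 1" "sigma3 $ 1 $ 2 = 0" "sigma3 $ 2 $ 1 = 0" "sigma3 $ 2 $ 2 = -1"
  by (simp_all add: sigma3_def)

lemma matrix_inv_sigma3: "matrix_inv sigma3 = sigma3"
  by (intro matrix_inv_eqI) (simp_all add: mat2_eq_iff mat2_mult_nth)

section \<open>The group SU(1,1) and its diagonal gauges\<close>

lemma SU11_iff:
  "A \<in> SU11 \<longleftrightarrow> A $ 2 $ 2 = cnj (A $ 1 $ 1) \<and> A $ 2 $ 1 = cnj (A $ 1 $ 2) \<and>
     A $ 1 $ 1 * cnj (A $ 1 $ 1) - A $ 1 $ 2 * cnj (A $ 1 $ 2) = 1" (is "_ \<longleftrightarrow> ?R")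
proof
  assume "A \<in> SU11"
  then have det: "A $ 1 $ 1 * A $ 2 $ 2 - A $ 1 $ 2 * A $ 2 $ 1 = 1"
    and e1: "cnj (A $ 1 $ 1) * A $ 1 $ 1 - cnj (A $ 2 $ 1) * A $ 2 $ 1 = 1"
    and e2: "cnj (A $ 1 $ 1) * A $ 1 $ 2 - cnj (A $ 2 $ 1) * A $ 2 $ 2 = 0"
    by (auto simp: SU11_def SL2C_def det_2 mat2_eq_iff mat2_mult_nth transpose_def map_matrix_def)
  have d: "A $ 2 $ 2 = cnj (A $ 1 $ 1)" using det e1 e2 by algebra
  have b: "A $ 1 $ 2 = cnj (A $ 2 $ 1)" using det e1 e2 by algebra
  show ?R using d b e1 by (simp add: mult.commute)
next
  assume ?R
  then show "A \<in> SU11"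
    by (auto simp: SU11_def SL2C_def det_2 mat2_eq_iff mat2_mult_nth transpose_def map_matrix_def algebra_simps)
qed

lemma SU11_D:
  assumes "A \<in> SU11"
  shows "A $ 2 $ 2 = cnj (A $ 1 $ 1)" "A $ 2 $ 1 = cnj (A $ 1 $ 2)"
    "A $ 1 $ 1 * cnj (A $ 1 $ 1) - A $ 1 $ 2 * cnj (A $ 1 $ 2) = 1" "det A = 1"
    using assms SU11_iff[of A] by (auto simp: SU11_def SL2C_def)

lemma SU11_mult: "A \<in> SU11 \<Longrightarrow> B \<in> SU11 \<Longrightarrow> A ** B \<in> SU11"
proof -
  assume "A \<in> SU11" "B \<in> SU11"
  moreover have "(A $ 1 $ 1 * B $ 1 $ 1 + A $ 1 $ 2 * cnj (B $ 1 $ 2)) *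
      (cnj (A $ 1 $ 1) * cnj (B $ 1 $ 1) + cnj (A $ 1 $ 2) * B $ 1 $ 2) -
      (A $ 1 $ 1 * B $ 1 $ 2 + A $ 1 $ 2 * cnj (B $ 1 $ 1)) *
      (cnj (A $ 1 $ 1) * cnj (B $ 1 $ 2) + cnj (A $ 1 $ 2) * B $ 1 $ 1) =
      (A $ 1 $ 1 * cnj (A $ 1 $ 1) - A $ 1 $ 2 * cnj (A $ 1 $ 2)) *
      (B $ 1 $ 1 * cnj (B $ 1 $ 1) - B $ 1 $ 2 * cnj (B $ 1 $ 2))"
    by (simp add: algebra_simps)
  ultimately show ?thesis unfolding SU11_iff by (simp add: mat2_mult_nth)
qed

lemma SU11_adj2: "A \<in> SU11 \<Longrightarrow> adj2 A \<in> SU11"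
  unfolding SU11_iff by (simp add: mult.commute)

text \<open>Conjugation by a diagonal matrix of determinant 1 whose entries have the quotient \<open>\<delta>\<close>.\<close>

definition diag_conj :: "complex \<Rightarrow> mat2 \<Rightarrow> mat2" where
  "diag_conj \<delta> A = vector [vector [A $ 1 $ 1, \<delta> * A $ 1 $ 2], vector [A $ 2 $ 1 / \<delta>, A $ 2 $ 2]]"

lemma diag_conj_nth [simp]: "diag_conj \<delta> A $ 1 $ 1 = A $ 1 $ 1" "diag_conj \<delta> A $ 1 $ 2 = \<delta> * A $ 1 $ 2"
  "diag_conj \<delta> A $ 2 $ 1 = A $ 2 $ 1 / \<delta>" "diag_conj \<delta> A $ 2 $ 2 = A $ 2 $ 2"
  by (simp_all add: diag_conj_def)

lemma diag_conj_mult: "\<delta> \<noteq> 0 \<Longrightarrow> diag_conj \<delta> (A ** B) = diag_conj \<delta> A ** diag_conj \<delta> B"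
  by (simp add: mat2_eq_iff mat2_mult_nth algebra_simps add_divide_distrib)

lemma det_diag_conj: "\<delta> \<noteq> 0 \<Longrightarrow> det (diag_conj \<delta> A) = det A"
  by (simp add: det_2)

lemma SU11_diag_conj: "norm \<delta> = 1 \<Longrightarrow> A \<in> SU11 \<Longrightarrow> diag_conj \<delta> A \<in> SU11"
proof -
  assume \<delta>: "norm \<delta> = 1" and A: "A \<in> SU11"
  have "\<delta> * cnj \<delta> = 1" using \<delta> by (simp flip: complex_norm_square)
  then have "cnj \<delta> = 1 / \<delta>" by (metis mult_zero_left nonzero_eq_divide_eq mult.commute zero_neq_one)
  then show ?thesis using A \<delta> unfolding SU11_iff by auto
qed

section \<open>The differential equation\<close>

definition radial_solution :: "nat \<Rightarrow> complex \<Rightarrow> complex \<Rightarrow> (complex \<Rightarrow> mat2) \<Rightarrow> bool" where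
  "radial_solution k c l \<Phi> \<longleftrightarrow> \<Phi> 0 = mat 1 \<and>
     (\<forall>z. (\<Phi> has_derivative (\<lambda>h. \<Phi> z ** radial_potential k c l z h)) (at z))"

lemma radial_potential_nth [simp]:
  "radial_potential k c l z h $ 1 $ 1 = 0" "radial_potential k c l z h $ 1 $ 2 = inverse l * h"
  "radial_potential k c l z h $ 2 $ 1 = inverse l * (c * z ^ k) * h" "radial_potential k c l z h $ 2 $ 2 = 0"
  by (simp_all add: radial_potential_def map_matrix_def)

lemma has_derivative_vec_iff:
  fixes f :: "'a::real_normed_vector \<Rightarrow> 'b::euclidean_space ^ 'n"
  shows "(f has_derivative f') (at x) \<longleftrightarrow> (\<forall>i. ((\<lambda>x. f x $ i) has_derivative (\<lambda>h. f' h $ i)) (at x))"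
  by (subst has_derivative_componentwise_within, subst (2) has_derivative_componentwise_within)
    (auto simp: Basis_vec_def inner_axis)

lemma isCont_mat2I:
  fixes f :: "'a::t2_space \<Rightarrow> mat2"
  shows "(\<And>i j. isCont (\<lambda>x. f x $ i $ j) a) \<Longrightarrow> isCont f a"
  by (simp add: isCont_def vec_tendstoI)

text \<open>The potential is complex linear in \<open>h\<close>, so the real derivative is a complex
  one, and each row of \<open>\<Phi>\<close> solves the same two-dimensional linear system.\<close>

lemma radial_solution_iff:
  "radial_solution k c l \<Phi> \<longleftrightarrow> \<Phi> 0 = mat 1 \<and>
     (\<forall>z i. ((\<lambda>z. \<Phi> z $ i $ 1) has_field_derivative inverse l * (c * z ^ k) * \<Phi> z $ i $ 2) (at z) \<and>
            ((\<lambda>z. \<Phi> z $ i $ 2) has_field_derivative inverse l * \<Phi> z $ i $ 1) (at z))"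
  unfolding radial_solution_def has_derivative_vec_iff has_field_derivative_def forall_2 mat2_mult_nth
  by (simp add: mult_ac mult_commute_abs)

text \<open>The coefficient matrix of the system has trace 0, so the Wronskian of two rows has
  derivative 0. The determinant and the uniqueness of solutions both rest on this.\<close>

lemma radial_wronskian:
  assumes "\<And>z. (a has_field_derivative q z * b z) (at z)" "\<And>z. (b has_field_derivative p * a z) (at z)"
    and "\<And>z. (a' has_field_derivative q z * b' z) (at z)" "\<And>z. (b' has_field_derivative p * a' z) (at z)"
  shows "a z * b' z - b z * a' z = a 0 * b' 0 - b 0 * a' (0 :: complex)"
proof -
  have "((\<lambda>z. a z * b' z - b z * a' z) has_field_derivative 0) (at z within UNIV)" for z
    by (rule derivative_eq_intros assms refl)+ (simp add: algebra_simps)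
  then show ?thesis
    using has_field_derivative_zero_constant[of UNIV "\<lambda>z. a z * b' z - b z * a' z"] by (metis convex_UNIV UNIV_I)
qed

lemma radial_solution_det:
  assumes "radial_solution k c l \<Phi>"
  shows "det (\<Phi> z) = 1"
proof -
  have "\<Phi> z $ 1 $ 1 * \<Phi> z $ 2 $ 2 - \<Phi> z $ 1 $ 2 * \<Phi> z $ 2 $ 1 =
      \<Phi> 0 $ 1 $ 1 * \<Phi> 0 $ 2 $ 2 - \<Phi> 0 $ 1 $ 2 * \<Phi> 0 $ 2 $ 1"
    using assms unfolding radial_solution_iff by (intro radial_wronskian) blast+
  then show ?thesis using assms by (simp add: det_2 radial_solution_iff)
qed

text \<open>The entries of \<open>\<Phi> z ** adj2 (\<Psi> z)\<close> are, up to sign, Wronskians of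
  a row of \<open>\<Phi>\<close> with a row of \<open>\<Psi>\<close>. They keep their values at 0,
  so the product is the identity.\<close>

lemma radial_solution_unique:
  assumes \<Phi>: "radial_solution k c l \<Phi>" and \<Psi>: "radial_solution k c l \<Psi>"
  shows "\<Phi> z = \<Psi> z"
proof -
  have w: "\<Phi> z $ i $ 1 * \<Psi> z $ j $ 2 - \<Phi> z $ i $ 2 * \<Psi> z $ j $ 1 =
      \<Phi> 0 $ i $ 1 * \<Psi> 0 $ j $ 2 - \<Phi> 0 $ i $ 2 * \<Psi> 0 $ j $ 1" for i j
    using assms unfolding radial_solution_iff by (intro radial_wronskian) blast+
  have "\<Phi> z ** adj2 (\<Psi> z) = mat 1"
    using assms w[of 1 1] w[of 1 2] w[of 2 1] w[of 2 2]
    by (simp add: mat2_eq_iff mat2_mult_nth radial_solution_iff) (metis minus_diff_eq minus_minus)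
  then have "\<Phi> z ** (adj2 (\<Psi> z) ** \<Psi> z) = \<Psi> z" by (simp add: matrix_mul_assoc)
  then show ?thesis using adj2_mult_left[OF radial_solution_det[OF \<Psi>]] by simp
qed

text \<open>
  Rotating the variable amounts to rotating the loop parameter and a constant diagonal gauge.
\<close>

lemma radial_solution_rotate:
  assumes \<Phi>: "radial_solution k c l \<Phi>" and \<Psi>: "radial_solution k c l' \<Psi>"
    and l: "l \<noteq> 0" and \<theta>: "l' = l * cis (- (real k + 2) * \<theta> / 2)"
  shows "diag_conj (cis (real k * \<theta> / 2)) (\<Phi> (cis \<theta> * z)) = \<Psi> z"
proof (rule radial_solution_unique[OF _ \<Psi>])
  \<comment> \<open>Rotating \<open>z\<close> multiplies the two entries of the potential by
    \<open>cis \<theta>\<close> and \<open>cis ((k + 1) * \<theta>)\<close>. Conjugation multiplies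
    them by \<open>\<delta>\<close> and \<open>1 / \<delta>\<close>; this \<open>\<delta>\<close>
    makes both factors equal to \<open>cis ((k + 2) * \<theta> / 2)\<close>, which the change from
    \<open>l\<close> to \<open>l'\<close> absorbs.\<close>
  define \<delta> where "\<delta> = cis (real k * \<theta> / 2)"
  have \<delta>: "\<delta> \<noteq> 0" by (simp add: \<delta>_def)
  have angle: "- (- (real k + 2) * \<theta> / 2) = real k * \<theta> / 2 + \<theta>" by (simp add: field_simps)
  have l': "inverse l' = inverse l * (\<delta> * cis \<theta>)"
    by (simp only: \<theta> inverse_mult_distrib cis_inverse angle \<delta>_def cis_mult)
  have \<zeta>: "cis \<theta> ^ k = \<delta> ^ 2"
    unfolding \<delta>_def Complex.DeMoivre by (rule arg_cong[of _ _ cis]) simp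
  have chain: "((\<lambda>z. f (cis \<theta> * z)) has_field_derivative D * cis \<theta>) (at z)"
    if "(f has_field_derivative D) (at (cis \<theta> * z))" for f D z
    by (rule DERIV_chain2[where f = f and g = "\<lambda>z. cis \<theta> * z", OF that])
      (auto intro!: derivative_eq_intros)
  have d: "((\<lambda>z. \<Phi> (cis \<theta> * z) $ i $ 1) has_field_derivative
        inverse l * (c * (cis \<theta> * z) ^ k) * \<Phi> (cis \<theta> * z) $ i $ 2 * cis \<theta>) (at z)"
    "((\<lambda>z. \<Phi> (cis \<theta> * z) $ i $ 2) has_field_derivative
        inverse l * \<Phi> (cis \<theta> * z) $ i $ 1 * cis \<theta>) (at z)" for z i
    using \<Phi> unfolding radial_solution_iff by (auto intro: chain)
  have "((\<lambda>z. \<delta> * \<Phi> (cis \<theta> * z) $ 1 $ 2) has_field_derivative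
        \<delta> * (inverse l * \<Phi> (cis \<theta> * z) $ 1 $ 1 * cis \<theta>)) (at z)"
       "((\<lambda>z. \<Phi> (cis \<theta> * z) $ 2 $ 1 / \<delta>) has_field_derivative
        inverse l * (c * (cis \<theta> * z) ^ k) * \<Phi> (cis \<theta> * z) $ 2 $ 2 * cis \<theta> / \<delta>) (at z)" for z
    by (intro DERIV_cmult DERIV_cdivide d)+
  note d' = this d[of 1] d[of 2]
  have pow: "(cis \<theta> * z) ^ k = \<delta> * \<delta> * z ^ k" for z
    by (simp add: power_mult_distrib \<zeta> power2_eq_square)
  have "((\<lambda>z. diag_conj \<delta> (\<Phi> (cis \<theta> * z)) $ i $ 1) has_field_derivative
      inverse l' * (c * z ^ k) * diag_conj \<delta> (\<Phi> (cis \<theta> * z)) $ i $ 2) (at z)"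
    "((\<lambda>z. diag_conj \<delta> (\<Phi> (cis \<theta> * z)) $ i $ 2) has_field_derivative
      inverse l' * diag_conj \<delta> (\<Phi> (cis \<theta> * z)) $ i $ 1) (at z)" for i z
    using exhaust_2[of i] d'[of z, unfolded pow] \<delta> by (auto simp: l' mult_ac)
  moreover have "diag_conj \<delta> (\<Phi> (cis \<theta> * 0)) = mat 1"
    using \<Phi> by (simp add: radial_solution_iff mat2_eq_iff)
  ultimately show "radial_solution k c l' (\<lambda>z. diag_conj (cis (real k * \<theta> / 2)) (\<Phi> (cis \<theta> * z)))"
    unfolding radial_solution_iff \<delta>_def by blast
qed

text \<open>The rotation law gives continuity in the loop parameter: on the circle every solution is
  a rotated and gauged copy of the one at a fixed \<open>l0\<close>, by an angle that is continuous
  at \<open>l0\<close>.\<close>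

lemma radial_solution_continuous:
  assumes \<Phi>: "\<And>l. l \<in> unit_circle \<Longrightarrow> radial_solution k c l (\<lambda>z. \<Phi> z l)"
  shows "continuous_on (UNIV \<times> unit_circle) (\<lambda>(z, l). \<Phi> z l)"
  unfolding continuous_on_eq_continuous_within
proof (clarify)
  fix w0 l0 :: complex assume l0: "l0 \<in> unit_circle"
  \<comment> \<open>The angle solves \<open>l0 = l * cis (- (real k + 2) * \<theta> l / 2)\<close>.
    For \<open>l\<close> near \<open>l0\<close> the quotient \<open>l / l0\<close> is near 1, where
    the principal logarithm is continuous.\<close>
  define \<theta> where "\<theta> l = 2 * Im (Ln (l / l0)) / (real k + 2)" for l
  define G where "G w l = diag_conj (1 / cis (real k * \<theta> l / 2)) (\<Phi> (cis (- \<theta> l) * w) l0)" for w l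
  have G: "\<Phi> w l = G w l" if l: "l \<in> unit_circle" for w l
  proof -
    have n: "l / l0 \<noteq> 0" "norm (l / l0) = 1" using l l0 by (auto simp: norm_divide)
    have "cis (Im (Ln (l / l0))) = exp (Ln (l / l0))"
      using n by (simp add: exp_eq_polar)
    then have "cis (Im (Ln (l / l0))) = l / l0" using n by simp
    moreover have "- (real k + 2) * \<theta> l / 2 = - Im (Ln (l / l0))"
    proof -
      have "- N * (2 * x / N) / 2 = - x" if "N \<noteq> 0" for N x :: real using that by simp
      from this[of "real k + 2" "Im (Ln (l / l0))"] show ?thesis unfolding \<theta>_def by linarith
    qed
    ultimately have "l0 = l * cis (- (real k + 2) * \<theta> l / 2)"
      using n by (simp add: cis_inverse[symmetric] del: Im_Ln_eq)
    then have "diag_conj (cis (real k * \<theta> l / 2)) (\<Phi> (cis (\<theta> l) * (cis (- \<theta> l) * w)) l) =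
        \<Phi> (cis (- \<theta> l) * w) l0"
      using l by (intro radial_solution_rotate[OF \<Phi> \<Phi>[OF l0]]) auto
    then have "G w l = diag_conj (1 / cis (real k * \<theta> l / 2)) (diag_conj (cis (real k * \<theta> l / 2)) (\<Phi> w l))"
      by (simp add: G_def cis_mult flip: mult.assoc)
    then show ?thesis by (simp add: mat2_eq_iff)
  qed
  have \<theta>: "isCont (\<lambda>p. \<theta> (snd p)) (w0, l0)"
    using l0 unfolding \<theta>_def by (intro continuous_intros isCont_Im isCont_Ln') auto
  have \<Phi>0: "isCont (\<lambda>z. \<Phi> z l0 $ i $ j) z" for z i j
  proof -
    have "isCont (\<lambda>z. \<Phi> z l0 $ i $ 1) z" "isCont (\<lambda>z. \<Phi> z l0 $ i $ 2) z"
      using \<Phi>[OF l0] unfolding radial_solution_iff by (auto intro: DERIV_isCont)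
    then show ?thesis using exhaust_2[of j] by auto
  qed
  have cis: "isCont (\<lambda>p. cis (f p)) p" if "isCont f p" for f and p :: "complex \<times> complex"
    using that by (simp add: isCont_def tendsto_cis)
  have ident: "isCont fst p" for p :: "complex \<times> complex"
    by (simp add: continuous_fst)
  have M: "isCont (\<lambda>p. \<Phi> (cis (- \<theta> (snd p)) * fst p) l0 $ i $ j) (w0, l0)" for i j
    by (rule isCont_o2[where g = "\<lambda>z. \<Phi> z l0 $ i $ j", OF _ \<Phi>0]) (intro continuous_mult cis continuous_minus \<theta> ident)
  have "isCont (\<lambda>p. G (fst p) (snd p)) (w0, l0)"
    unfolding G_def
  proof (intro isCont_mat2I)
    fix i j :: 2
    have "isCont (\<lambda>p. cis (real k * \<theta> (snd p) / 2)) (w0, l0)"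
      by (intro cis continuous_divide continuous_mult \<theta> continuous_const) auto
    with M[of 1] M[of 2] show "isCont (\<lambda>p. diag_conj (1 / cis (real k * \<theta> (snd p) / 2))
        (\<Phi> (cis (- \<theta> (snd p)) * fst p) l0) $ i $ j) (w0, l0)"
      using exhaust_2[of i] exhaust_2[of j] by (auto intro!: continuous_mult continuous_divide continuous_const)
  qed
  then have "continuous (at (w0, l0) within UNIV \<times> unit_circle) (\<lambda>p. G (fst p) (snd p))"
    by (rule continuous_at_imp_continuous_at_within)
  then show "continuous (at (w0, l0) within UNIV \<times> unit_circle) (\<lambda>(z, l). \<Phi> z l)"
    by (rule continuous_transform_within[of _ _ _ 1]) (use G l0 in \<open>auto simp: case_prod_beta\<close>)
qed

section \<open>Smooth families\<close>

definition has_partials :: "complex set \<Rightarrow> 'p set \<Rightarrow> (complex \<Rightarrow> 'p \<Rightarrow> 'b::real_normed_vector) \<Rightarrow>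
    (complex \<Rightarrow> 'p \<Rightarrow> 'b) \<Rightarrow> (complex \<Rightarrow> 'p \<Rightarrow> 'b) \<Rightarrow> bool" where
  "has_partials U L g gx gy \<longleftrightarrow> (\<forall>z\<in>U. \<forall>p\<in>L.
     ((\<lambda>w. g w p) has_derivative (\<lambda>h. Re h *\<^sub>R gx z p + Im h *\<^sub>R gy z p)) (at z))"

lemma has_partialsD:
  "has_partials U L g gx gy \<Longrightarrow> z \<in> U \<Longrightarrow> p \<in> L \<Longrightarrow>
     ((\<lambda>w. g w p) has_derivative (\<lambda>h. Re h *\<^sub>R gx z p + Im h *\<^sub>R gy z p)) (at z)"
  by (simp add: has_partials_def)

lemma Ck_family_Suc_iff:
  "Ck_family (Suc n) U L g \<longleftrightarrow> continuous_on (U \<times> L) (\<lambda>(z, p). g z p) \<and>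
     (\<exists>gx gy. has_partials U L g gx gy \<and> Ck_family n U L gx \<and> Ck_family n U L gy)"
  by (simp only: Ck_family.simps has_partials_def)

lemma Ck_family_continuous: "Ck_family n U L g \<Longrightarrow> continuous_on (U \<times> L) (\<lambda>(z, p). g z p)"
  by (cases n) (simp_all only: Ck_family.simps)

lemma Ck_family_SucD: "Ck_family (Suc n) U L g \<Longrightarrow> Ck_family n U L g"
proof (induction n arbitrary: g)
  case (Suc n)
  then obtain gx gy where "has_partials U L g gx gy" "Ck_family (Suc n) U L gx" "Ck_family (Suc n) U L gy"
    using Ck_family_Suc_iff by blast
  moreover from this have "Ck_family n U L gx" "Ck_family n U L gy" by (blast intro: Suc.IH)+
  ultimately show ?case using Ck_family_continuous[OF Suc.prems] Ck_family_Suc_iff by blast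
qed (simp only: Ck_family.simps)

lemma Ck_family_cong:
  assumes U: "open U" and eq: "\<And>z p. z \<in> U \<Longrightarrow> p \<in> L \<Longrightarrow> f z p = g z p" and f: "Ck_family n U L f"
  shows "Ck_family n U L g"
proof -
  have c: "continuous_on (U \<times> L) (\<lambda>(z, p). g z p)"
    using Ck_family_continuous[OF f] by (rule continuous_on_eq) (use eq in auto)
  have d: "has_partials U L g gx gy" if "has_partials U L f gx gy" for gx gy
    unfolding has_partials_def
  proof (intro ballI)
    fix z p assume z: "z \<in> U" and p: "p \<in> L"
    show "((\<lambda>w. g w p) has_derivative (\<lambda>h. Re h *\<^sub>R gx z p + Im h *\<^sub>R gy z p)) (at z)"
      by (rule has_derivative_transform_within_open[OF has_partialsD[OF that z p] U z]) (use eq p in auto)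
  qed
  show ?thesis
  proof (cases n)
    case 0
    then show ?thesis using c by simp
  next
    case (Suc m)
    then show ?thesis using f c d unfolding Suc Ck_family_Suc_iff by blast
  qed
qed

lemma Ck_family_add: "Ck_family n U L f \<Longrightarrow> Ck_family n U L g \<Longrightarrow> Ck_family n U L (\<lambda>z p. f z p + g z p)"
proof (induction n arbitrary: f g)
  case 0
  then show ?case using continuous_on_add[of "U \<times> L" "\<lambda>(z, p). f z p" "\<lambda>(z, p). g z p"]
    by (simp add: case_prod_beta)
next
  case (Suc n)
  obtain fx fy where f: "has_partials U L f fx fy" "Ck_family n U L fx" "Ck_family n U L fy"
    using Suc.prems(1) Ck_family_Suc_iff by blast
  obtain gx gy where g: "has_partials U L g gx gy" "Ck_family n U L gx" "Ck_family n U L gy"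
    using Suc.prems(2) Ck_family_Suc_iff by blast
  have "has_partials U L (\<lambda>z p. f z p + g z p) (\<lambda>z p. fx z p + gx z p) (\<lambda>z p. fy z p + gy z p)"
    unfolding has_partials_def
  proof (intro ballI)
    fix z p assume "z \<in> U" "p \<in> L"
    from has_derivative_add[OF has_partialsD[OF f(1) this] has_partialsD[OF g(1) this]]
    show "((\<lambda>w. f w p + g w p) has_derivative
        (\<lambda>h. Re h *\<^sub>R (fx z p + gx z p) + Im h *\<^sub>R (fy z p + gy z p))) (at z)"
      by (simp add: algebra_simps)
  qed
  moreover have "Ck_family n U L (\<lambda>z p. fx z p + gx z p)" "Ck_family n U L (\<lambda>z p. fy z p + gy z p)"
    by (rule Suc.IH; fact)+
  moreover have "continuous_on (U \<times> L) (\<lambda>(z, p). f z p + g z p)"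
    by (rule Ck_family_continuous, rule Suc.IH; rule Ck_family_SucD; fact)
  ultimately show ?case unfolding Ck_family_Suc_iff by blast
qed

text \<open>By the Leibniz rule the partials are sums of bilinear terms in families of one order
  less, so the induction on the order closes.\<close>

lemma Ck_family_bilinear:
  assumes "bounded_bilinear b"
  shows "Ck_family n U L f \<Longrightarrow> Ck_family n U L g \<Longrightarrow> Ck_family n U L (\<lambda>z p. b (f z p) (g z p))"
proof (induction n arbitrary: f g)
  case 0
  then show ?case using bounded_bilinear.continuous_on[OF assms, of "U \<times> L" "\<lambda>(z, p). f z p" "\<lambda>(z, p). g z p"]
    by (simp add: case_prod_beta)
next
  case (Suc n)
  interpret bounded_bilinear b by fact
  obtain fx fy where f: "has_partials U L f fx fy" "Ck_family n U L fx" "Ck_family n U L fy"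
    using Suc.prems(1) Ck_family_Suc_iff by blast
  obtain gx gy where g: "has_partials U L g gx gy" "Ck_family n U L gx" "Ck_family n U L gy"
    using Suc.prems(2) Ck_family_Suc_iff by blast
  have fg: "Ck_family n U L f" "Ck_family n U L g" by (rule Ck_family_SucD; fact)+
  have "has_partials U L (\<lambda>z p. b (f z p) (g z p))
      (\<lambda>z p. b (f z p) (gx z p) + b (fx z p) (g z p)) (\<lambda>z p. b (f z p) (gy z p) + b (fy z p) (g z p))"
    unfolding has_partials_def
  proof (intro ballI)
    fix z p assume "z \<in> U" "p \<in> L"
    from FDERIV[OF has_partialsD[OF f(1) this] has_partialsD[OF g(1) this]]
    show "((\<lambda>w. b (f w p) (g w p)) has_derivative
        (\<lambda>h. Re h *\<^sub>R (b (f z p) (gx z p) + b (fx z p) (g z p)) +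
             Im h *\<^sub>R (b (f z p) (gy z p) + b (fy z p) (g z p)))) (at z)"
      by (simp add: algebra_simps add_left add_right scaleR_left scaleR_right)
  qed
  moreover have "Ck_family n U L (\<lambda>z p. b (f z p) (gx z p) + b (fx z p) (g z p))"
    "Ck_family n U L (\<lambda>z p. b (f z p) (gy z p) + b (fy z p) (g z p))"
    by (rule Ck_family_add; rule Suc.IH; fact)+
  moreover have "continuous_on (U \<times> L) (\<lambda>(z, p). b (f z p) (g z p))"
    using Suc.IH[OF fg, THEN Ck_family_continuous] .
  ultimately show ?case unfolding Ck_family_Suc_iff by blast
qed

lemma Ck_family_linear:
  assumes "bounded_linear T"
  shows "Ck_family n U L g \<Longrightarrow> Ck_family n U L (\<lambda>z p. T (g z p))"
proof (induction n arbitrary: g)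
  case 0
  then show ?case using bounded_linear.continuous_on[OF assms, of "U \<times> L" "\<lambda>(z, p). g z p"]
    by (simp add: case_prod_beta)
next
  case (Suc n)
  interpret bounded_linear T by fact
  obtain gx gy where g: "has_partials U L g gx gy" "Ck_family n U L gx" "Ck_family n U L gy"
    using Suc.prems Ck_family_Suc_iff by blast
  have "has_partials U L (\<lambda>z p. T (g z p)) (\<lambda>z p. T (gx z p)) (\<lambda>z p. T (gy z p))"
    unfolding has_partials_def
  proof (intro ballI)
    fix z p assume "z \<in> U" "p \<in> L"
    from has_derivative[OF has_partialsD[OF g(1) this]]
    show "((\<lambda>w. T (g w p)) has_derivative (\<lambda>h. Re h *\<^sub>R T (gx z p) + Im h *\<^sub>R T (gy z p))) (at z)"
      by (simp add: add scaleR)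
  qed
  moreover have "Ck_family n U L (\<lambda>z p. T (gx z p))" "Ck_family n U L (\<lambda>z p. T (gy z p))"
    by (rule Suc.IH; fact)+
  moreover have "continuous_on (U \<times> L) (\<lambda>(z, p). T (g z p))"
    using Suc.IH[OF Ck_family_SucD[OF Suc.prems], THEN Ck_family_continuous] .
  ultimately show ?case unfolding Ck_family_Suc_iff by blast
qed

text \<open>Freezing the parameter leads from families over the circle to \<open>smooth_map\<close>,
  whose parameter space is a single point.\<close>

lemma Ck_family_at_param:
  assumes "l \<in> L"
  shows "Ck_family n U L g \<Longrightarrow> Ck_family n U M (\<lambda>z p. g z l)"
proof (induction n arbitrary: g)
  case 0
  then have "continuous_on (U \<times> L) (\<lambda>(z, p). g z p)" by simp
  then have "continuous_on (U \<times> M) (\<lambda>x. case (fst x, l) of (z, p) \<Rightarrow> g z p)"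
    by (rule continuous_on_compose2) (use assms in \<open>auto intro!: continuous_intros\<close>)
  then show ?case by (simp add: case_prod_beta)
next
  case (Suc n)
  obtain gx gy where g: "has_partials U L g gx gy" "Ck_family n U L gx" "Ck_family n U L gy"
    using Suc.prems Ck_family_Suc_iff by blast
  have "has_partials U M (\<lambda>z p. g z l) (\<lambda>z p. gx z l) (\<lambda>z p. gy z l)"
    using g(1) assms by (simp add: has_partials_def)
  moreover have "Ck_family n U M (\<lambda>z p. gx z l)" "Ck_family n U M (\<lambda>z p. gy z l)"
    by (rule Suc.IH; fact)+
  moreover have "continuous_on (U \<times> M) (\<lambda>(z, p). g z l)"
    using Suc.IH[OF Ck_family_SucD[OF Suc.prems], THEN Ck_family_continuous] .
  ultimately show ?case unfolding Ck_family_Suc_iff by blast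
qed

section \<open>The Iwasawa factors\<close>

text \<open>The twisting makes the off-diagonal entries odd in \<open>l\<close>, so they vanish at
  the centre; determinant 1 passes from the circle to the disk by
  \<open>disk_algebra_eqI\<close>.\<close>

lemma twisted_plus_loopsE:
  assumes "B \<in> twisted_plus_loops"
  obtains C where "\<And>i j. (\<lambda>l. C l $ i $ j) \<in> disk_algebra" "\<And>l. l \<in> unit_circle \<Longrightarrow> B l = C l"
    "C 0 $ 1 $ 2 = 0" "C 0 $ 2 $ 1 = 0" "\<And>l. l \<in> cball 0 1 \<Longrightarrow> det (C l) = 1"
proof -
  have "\<forall>i j. \<exists>h. h \<in> disk_algebra \<and> (\<forall>l\<in>unit_circle. h l = B l $ i $ j)"
    using assms by (auto simp: twisted_plus_loops_def disk_algebra_def)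
  then obtain h where h: "\<And>i j. h i j \<in> disk_algebra" "\<And>i j l. l \<in> unit_circle \<Longrightarrow> h i j l = B l $ i $ j"
    by metis
  have B: "det (B l) = 1" "B (- l) = sigma3 ** B l ** sigma3" if "l \<in> unit_circle" for l
    using assms that by (auto simp: twisted_plus_loops_def twisted_loops_def SL2C_def matrix_inv_sigma3)
  have off: "h i j 0 = 0" if "(i, j) \<in> {(1, 2), (2, 1)}" for i j
  proof -
    \<comment> \<open>The sum of the values at \<open>l\<close> and \<open>- l\<close> vanishes on
      the circle by the twisting, hence also at 0, where it is twice \<open>h i j 0\<close>.\<close>
    have "h i j 0 + h i j (- 1 * 0) = 0"
    proof (rule disk_algebra_eqI[of "\<lambda>l. h i j l + h i j (- 1 * l)" "\<lambda>l. 0"])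
      show "(\<lambda>l. h i j l + h i j (- 1 * l)) \<in> disk_algebra"
        by (intro disk_algebra_add disk_algebra_rotate h) simp
      fix l :: complex assume l: "l \<in> unit_circle"
      then show "h i j l + h i j (- 1 * l) = 0"
        using that B(2)[OF l] h(2)[OF l] h(2)[of "- l"] by (auto simp: mat2_mult_nth)
    qed auto
    then show ?thesis by simp
  qed
  define C where "C l = (\<chi> i j. h i j l)" for l
  show thesis
  proof
    show "(\<lambda>l. C l $ i $ j) \<in> disk_algebra" for i j by (simp add: C_def h)
    show BC: "B l = C l" if "l \<in> unit_circle" for l using h(2)[OF that] by (simp add: C_def vec_eq_iff)
    show "C 0 $ 1 $ 2 = 0" "C 0 $ 2 $ 1 = 0" by (simp_all add: C_def off)
    show "det (C l) = 1" if "l \<in> cball 0 1" for l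
    proof (rule disk_algebra_eqI[OF _ disk_algebra_const _ that])
      show "(\<lambda>l. det (C l)) \<in> disk_algebra"
        unfolding det_2 C_def vec_lambda_beta by (intro disk_algebra_diff disk_algebra_mult h)
      show "det (C l) = 1" if "l \<in> unit_circle" for l using B(1)[OF that] BC[OF that] by simp
    qed
  qed
qed

text \<open>The source of uniqueness in the Iwasawa decomposition: the SU(1,1) relations make the
  entries of \<open>M\<close> pairwise conjugate on the circle, so
  \<open>disk_algebra_conj_imp_const\<close> applies to each.\<close>

lemma SU11_disk_algebra_const:
  assumes M: "\<And>i j. (\<lambda>l. (M l :: mat2) $ i $ j) \<in> disk_algebra"
    and SU: "\<And>l. l \<in> unit_circle \<Longrightarrow> M l \<in> SU11" and l: "l \<in> unit_circle"
  shows "M l = M 0"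
proof -
  have l': "l \<in> cball 0 1" using l by simp
  have "M l $ 1 $ 1 = M 0 $ 1 $ 1"
    by (rule disk_algebra_conj_imp_const[OF M[of 1 1] M[of 2 2] _ l']) (simp add: SU11_D(1,2)[OF SU])
  moreover have "M l $ 2 $ 2 = M 0 $ 2 $ 2"
    by (rule disk_algebra_conj_imp_const[OF M[of 2 2] M[of 1 1] _ l']) (simp add: SU11_D(1,2)[OF SU])
  moreover have "M l $ 1 $ 2 = M 0 $ 1 $ 2"
    by (rule disk_algebra_conj_imp_const[OF M[of 1 2] M[of 2 1] _ l']) (simp add: SU11_D(1,2)[OF SU])
  moreover have "M l $ 2 $ 1 = M 0 $ 2 $ 1"
    by (rule disk_algebra_conj_imp_const[OF M[of 2 1] M[of 1 2] _ l']) (simp add: SU11_D(1,2)[OF SU])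
  ultimately show ?thesis by (simp add: mat2_eq_iff)
qed

lemma has_vector_derivative_line:
  assumes "(f has_derivative f') (at (z + t *\<^sub>R h))"
  shows "((\<lambda>s. f (z + s *\<^sub>R h)) has_vector_derivative f' h) (at t)"
proof -
  have "((\<lambda>s. z + s *\<^sub>R h) has_derivative (\<lambda>s. s *\<^sub>R h)) (at t)"
    by (auto intro!: derivative_eq_intros)
  from has_derivative_compose[OF this assms]
  show ?thesis
    by (simp add: has_vector_derivative_def linear_scale[OF has_derivative_linear[OF assms]])
qed

lemma continuous_on_mat2I:
  fixes f :: "'a::topological_space \<Rightarrow> mat2"
  shows "(\<And>i j. continuous_on S (\<lambda>x. f x $ i $ j)) \<Longrightarrow> continuous_on S f"
  by (simp add: continuous_on_def vec_tendstoI)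

lemma continuous_on_radial_potential:
  "continuous_on (UNIV \<times> unit_circle) (\<lambda>(z, l). radial_potential k c l z h)"
proof (rule continuous_on_mat2I)
  show "continuous_on (UNIV \<times> unit_circle) (\<lambda>x. (case x of (z, l) \<Rightarrow> radial_potential k c l z h) $ i $ j)" for i j
    using exhaust_2[of i] exhaust_2[of j]
    by (elim disjE; simp add: case_prod_beta; auto intro!: continuous_intros)
qed

text \<open>
  The Maurer--Cartan form of a frame, evaluated on the tangent vector \<open>h\<close>. It is
  \<open>h W + cnj h W'\<close> with \<open>W = [[w, \<beta> / l], [\<gamma> / l, - w]]\<close> and \<open>W'\<close> such that the
  sum lies in the Lie algebra of \<open>SU(1,1)\<close>; on the unit circle \<open>1 / l = cnj l\<close>.
\<close>

definition mc_coeff :: "complex \<Rightarrow> complex \<Rightarrow> complex \<Rightarrow> complex \<Rightarrow> complex" where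
  "mc_coeff \<beta> \<gamma> l h = h * \<beta> * cnj l + cnj (h * \<gamma>) * l"

definition mc_form :: "complex \<Rightarrow> complex \<Rightarrow> complex \<Rightarrow> complex \<Rightarrow> complex \<Rightarrow> mat2" where
  "mc_form \<beta> \<gamma> w l h = vector
     [vector [h * w - cnj (h * w), mc_coeff \<beta> \<gamma> l h],
      vector [cnj (mc_coeff \<beta> \<gamma> l h), cnj (h * w) - h * w]]"

lemma mc_form_nth [simp]:
  "mc_form \<beta> \<gamma> w l h $ 1 $ 1 = h * w - cnj (h * w)" "mc_form \<beta> \<gamma> w l h $ 1 $ 2 = mc_coeff \<beta> \<gamma> l h"
  "mc_form \<beta> \<gamma> w l h $ 2 $ 1 = cnj (mc_coeff \<beta> \<gamma> l h)" "mc_form \<beta> \<gamma> w l h $ 2 $ 2 = cnj (h * w) - h * w"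
  by (simp_all add: mc_form_def)

lemma mat2_scaleR_nth: "(s *\<^sub>R (A :: mat2)) $ i $ j = of_real s * A $ i $ j"
  by (simp only: vector_scaleR_component scaleR_conv_of_real[of s "A $ i $ j"])

text \<open>\<open>C z\<close> is the holomorphic extension to the disk of the second Iwasawa factor.\<close>

locale radial_frame =
  fixes k :: nat and c :: complex and U :: "complex set" and F \<Phi> C :: "complex \<Rightarrow> complex \<Rightarrow> mat2"
  assumes open_U: "open U"
    and smooth: "smooth_family U unit_circle F"
    and solution: "l \<in> unit_circle \<Longrightarrow> radial_solution k c l (\<lambda>z. \<Phi> z l)"
    and F_SU11: "z \<in> U \<Longrightarrow> l \<in> unit_circle \<Longrightarrow> F z l \<in> SU11"
    and F_twist: "z \<in> U \<Longrightarrow> l \<in> unit_circle \<Longrightarrow> F z (- l) = sigma3 ** F z l ** sigma3"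
    and factor: "z \<in> U \<Longrightarrow> l \<in> unit_circle \<Longrightarrow> \<Phi> z l = F z l ** C z l"
    and C_disk: "z \<in> U \<Longrightarrow> (\<lambda>l. C z l $ i $ j) \<in> disk_algebra"
    and C_off: "z \<in> U \<Longrightarrow> C z 0 $ 1 $ 2 = 0" "z \<in> U \<Longrightarrow> C z 0 $ 2 $ 1 = 0"
    and C_det: "z \<in> U \<Longrightarrow> l \<in> cball 0 1 \<Longrightarrow> det (C z l) = 1"

lemma extended_frame_imp_radial_frame:
  assumes "open U" "extended_frame k c U F"
  obtains \<Phi> C where "radial_frame k c U F \<Phi> C"
proof -
  obtain \<Phi> B where smooth: "smooth_family U unit_circle F"
    and \<Phi>: "\<forall>l\<in>unit_circle. \<Phi> 0 l = mat 1 \<and> (\<forall>z. ((\<lambda>w. \<Phi> w l) has_derivative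
                  (\<lambda>h. \<Phi> z l ** radial_potential k c l z h)) (at z))"
    and FB: "\<forall>z\<in>U. F z \<in> twisted_loops SU11 \<and> B z \<in> twisted_plus_loops \<and>
           (\<forall>l\<in>unit_circle. \<Phi> z l = F z l ** B z l)"
    using assms(2) unfolding extended_frame_def by (elim conjE exE)
  have "\<forall>z\<in>U. \<exists>C. (\<forall>i j. (\<lambda>l. C l $ i $ j) \<in> disk_algebra) \<and> (\<forall>l\<in>unit_circle. B z l = C l) \<and>
      C 0 $ 1 $ 2 = 0 \<and> C 0 $ 2 $ 1 = 0 \<and> (\<forall>l\<in>cball 0 1. det (C l) = 1)"
    using FB by (metis twisted_plus_loopsE)
  then obtain C where C: "\<forall>z\<in>U. (\<forall>i j. (\<lambda>l. C z l $ i $ j) \<in> disk_algebra) \<and> (\<forall>l\<in>unit_circle. B z l = C z l) \<and>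
      C z 0 $ 1 $ 2 = 0 \<and> C z 0 $ 2 $ 1 = 0 \<and> (\<forall>l\<in>cball 0 1. det (C z l) = 1)"
    by (rule bchoice[THEN exE])
  have "radial_frame k c U F \<Phi> C"
  proof
    show "radial_solution k c l (\<lambda>z. \<Phi> z l)" if "l \<in> unit_circle" for l
      using \<Phi> that by (simp add: radial_solution_def)
    show "F z l \<in> SU11" "F z (- l) = sigma3 ** F z l ** sigma3" if "z \<in> U" "l \<in> unit_circle" for z l
      using FB that by (auto simp: twisted_loops_def matrix_inv_sigma3)
    show "\<Phi> z l = F z l ** C z l" if "z \<in> U" "l \<in> unit_circle" for z l
      using FB C that by simp
  qed (use assms(1) smooth C in \<open>auto simp del: mem_cball\<close>)
  then show thesis by (rule that)
qed

section \<open>The Maurer-Cartan form of the frame\<close>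

context radial_frame
begin

text \<open>\<open>C z 0\<close> is diagonal of determinant 1; \<open>\<beta>\<close> and
  \<open>\<gamma>\<close> are the off-diagonal entries of the coefficient matrix of the potential
  conjugated by it.\<close>

definition \<beta> :: "complex \<Rightarrow> complex" where "\<beta> z = (C z 0 $ 1 $ 1)\<^sup>2"

definition \<gamma> :: "complex \<Rightarrow> complex" where "\<gamma> z = c * z ^ k * (C z 0 $ 2 $ 2)\<^sup>2"

lemma C_diag: "z \<in> U \<Longrightarrow> C z 0 $ 1 $ 1 * C z 0 $ 2 $ 2 = 1"
  using C_det[of z 0] C_off[of z] by (simp add: det_2)

lemma adj2_F: "z \<in> U \<Longrightarrow> l \<in> unit_circle \<Longrightarrow> adj2 (F z l) ** F z l = mat 1"
  "z \<in> U \<Longrightarrow> l \<in> unit_circle \<Longrightarrow> F z l ** adj2 (F z l) = mat 1"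
  by (simp_all add: adj2_mult_left adj2_mult_right SU11_D(4)[OF F_SU11])

lemma C_eq: "z \<in> U \<Longrightarrow> l \<in> unit_circle \<Longrightarrow> C z l = adj2 (F z l) ** \<Phi> z l"
  by (simp add: factor matrix_mul_assoc adj2_F)

text \<open>The locale assumes no regularity of \<open>C\<close> in \<open>z\<close>. On the circle
  \<open>C = adj2 F ** \<Phi>\<close> is differentiable, and \<open>disk_algebra_derivative\<close>
  extends its derivative \<open>H\<close> to the disk. Differentiating
  \<open>\<Phi> = F ** C\<close> then expresses the Maurer-Cartan form of \<open>F\<close> by
  \<open>H\<close> and the potential.\<close>

lemma factor_derivative:
  assumes z: "z \<in> U" and F': "has_partials U unit_circle F Fx Fy"
    and cont: "continuous_on (U \<times> unit_circle) (\<lambda>(z, l). Fx z l)"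
      "continuous_on (U \<times> unit_circle) (\<lambda>(z, l). Fy z l)"
  defines "G \<equiv> \<lambda>h z l. Re h *\<^sub>R Fx z l + Im h *\<^sub>R Fy z l"
  obtains H where "\<And>i j. (\<lambda>l. H l $ i $ j) \<in> disk_algebra"
    "\<And>l. l \<in> unit_circle \<Longrightarrow> adj2 (F z l) ** G h z l = (C z l ** radial_potential k c l z h - H l) ** adj2 (C z l)"
    "\<And>i j. ((\<lambda>t. C (z + t *\<^sub>R h) 0 $ i $ j) has_vector_derivative H 0 $ i $ j) (at 0)"
proof -
  obtain e where e: "e > 0" "cball z e \<subseteq> U" using open_U z open_contains_cball by blast
  \<comment> \<open>This bound keeps the segment inside the ball; adding 1 covers
    \<open>h = 0\<close>.\<close>
  define \<delta> where "\<delta> = e / (norm h + 1)"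
  have \<delta>: "\<delta> > 0" using e(1) by (simp add: \<delta>_def add_nonneg_pos)
  have line: "z + t *\<^sub>R h \<in> U" if "\<bar>t\<bar> \<le> \<delta>" for t
  proof -
    have "\<bar>t\<bar> * norm h \<le> \<delta> * (norm h + 1)" using that by (intro mult_mono) auto
    also have "\<dots> = e" by (simp add: \<delta>_def add_nonneg_eq_0_iff)
    finally show ?thesis using e(2) by (auto simp: dist_norm)
  qed
  define D where "D t l = adj2 (F (z + t *\<^sub>R h) l) ** (\<Phi> (z + t *\<^sub>R h) l ** radial_potential k c l (z + t *\<^sub>R h) h) +
      adj2 (G h (z + t *\<^sub>R h) l) ** \<Phi> (z + t *\<^sub>R h) l" for t l
  have dF: "((\<lambda>t. F (z + t *\<^sub>R h) l) has_vector_derivative G h (z + t *\<^sub>R h) l) (at t)"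
    if "\<bar>t\<bar> \<le> \<delta>" "l \<in> unit_circle" for t l
    unfolding G_def by (rule has_vector_derivative_line[OF has_partialsD[OF F' line[OF that(1)] that(2)]])
  have d\<Phi>: "((\<lambda>t. \<Phi> (z + t *\<^sub>R h) l) has_vector_derivative
      \<Phi> (z + t *\<^sub>R h) l ** radial_potential k c l (z + t *\<^sub>R h) h) (at t)" if "l \<in> unit_circle" for t l
    using solution[OF that] unfolding radial_solution_def by (intro has_vector_derivative_line) blast
  have dC: "((\<lambda>t. C (z + t *\<^sub>R h) l) has_vector_derivative D t l) (at t)"
    if t: "\<bar>t\<bar> \<le> \<delta>" and l: "l \<in> unit_circle" for t l
  proof (rule has_vector_derivative_transform_within_open)
    show "((\<lambda>t. adj2 (F (z + t *\<^sub>R h) l) ** \<Phi> (z + t *\<^sub>R h) l) has_vector_derivative D t l) (at t)"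
      unfolding D_def
      by (intro bounded_bilinear.has_vector_derivative[OF bounded_bilinear_mat2_mult]
          bounded_linear.has_vector_derivative[OF bounded_linear_adj2] dF d\<Phi> t l)
    show "open {t. z + t *\<^sub>R h \<in> U}"
      using continuous_open_vimage[OF open_U, of "\<lambda>t. z + t *\<^sub>R h"]
      by (simp add: vimage_def continuous_intros)
    show "t \<in> {t. z + t *\<^sub>R h \<in> U}" using line[OF t] by simp
    show "adj2 (F (z + s *\<^sub>R h) l) ** \<Phi> (z + s *\<^sub>R h) l = C (z + s *\<^sub>R h) l" if "s \<in> {t. z + t *\<^sub>R h \<in> U}" for s
      using C_eq l that by simp
  qed
  have cF: "continuous_on (U \<times> unit_circle) (\<lambda>(z, l). F z l)"
    using smooth Ck_family_continuous unfolding smooth_family_def by blast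
  have c\<Phi>: "continuous_on (U \<times> unit_circle) (\<lambda>(z, l). \<Phi> z l)"
    by (rule continuous_on_subset[OF radial_solution_continuous[OF solution]]) auto
  have cp: "continuous_on (U \<times> unit_circle) (\<lambda>(z, l). radial_potential k c l z h)"
    by (rule continuous_on_subset[OF continuous_on_radial_potential]) auto
  have cG: "continuous_on (U \<times> unit_circle) (\<lambda>p. G h (fst p) (snd p))"
    using cont unfolding G_def case_prod_beta by (intro continuous_intros)
  have "continuous_on (U \<times> unit_circle) (\<lambda>p. adj2 (F (fst p) (snd p)) ** (\<Phi> (fst p) (snd p) ** radial_potential k c (snd p) (fst p) h) +
      adj2 (G h (fst p) (snd p)) ** \<Phi> (fst p) (snd p))"
    by (intro continuous_on_add bounded_bilinear.continuous_on[OF bounded_bilinear_mat2_mult]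
        bounded_linear.continuous_on[OF bounded_linear_adj2] cG
        cF[unfolded case_prod_beta] c\<Phi>[unfolded case_prod_beta] cp[unfolded case_prod_beta])
  then have "continuous_on ({-\<delta>..\<delta>} \<times> unit_circle) (\<lambda>q. (\<lambda>p. adj2 (F (fst p) (snd p)) ** (\<Phi> (fst p) (snd p) ** radial_potential k c (snd p) (fst p) h) +
      adj2 (G h (fst p) (snd p)) ** \<Phi> (fst p) (snd p)) (z + fst q *\<^sub>R h, snd q))"
    by (rule continuous_on_compose2) (auto intro!: continuous_intros line)
  then have cD: "continuous_on ({-\<delta>..\<delta>} \<times> unit_circle) (\<lambda>(t, l). D t l)"
    by (simp add: D_def case_prod_beta)
  have "\<exists>H. H \<in> disk_algebra \<and> (\<forall>l\<in>unit_circle. H l = D 0 l $ i $ j) \<and>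
      ((\<lambda>t. C (z + t *\<^sub>R h) 0 $ i $ j) has_vector_derivative H 0) (at 0)" for i j
  proof (rule disk_algebra_derivative[of \<delta> "\<lambda>t l. C (z + t *\<^sub>R h) l $ i $ j" "\<lambda>t l. D t l $ i $ j"])
    show "((\<lambda>t. C (z + t *\<^sub>R h) l $ i $ j) has_vector_derivative D t l $ i $ j) (at t)"
      if "\<bar>t\<bar> \<le> \<delta>" "l \<in> unit_circle" for t l
      by (intro bounded_linear.has_vector_derivative[OF bounded_linear_vec_nth] dC that)
    show "continuous_on ({-\<delta>..\<delta>} \<times> unit_circle) (\<lambda>(t, l). D t l $ i $ j)"
      using cD by (auto simp: case_prod_beta intro!: continuous_intros)
  qed (use \<delta> C_disk line in auto)
  then obtain h' where h': "\<And>i j. h' i j \<in> disk_algebra" "\<And>i j l. l \<in> unit_circle \<Longrightarrow> h' i j l = D 0 l $ i $ j"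
    "\<And>i j. ((\<lambda>t. C (z + t *\<^sub>R h) 0 $ i $ j) has_vector_derivative h' i j 0) (at 0)"
    by metis
  define H where "H l = (\<chi> i j. h' i j l)" for l
  show thesis
  proof
    show "(\<lambda>l. H l $ i $ j) \<in> disk_algebra" for i j by (simp add: H_def h')
    show "((\<lambda>t. C (z + t *\<^sub>R h) 0 $ i $ j) has_vector_derivative H 0 $ i $ j) (at 0)" for i j
      by (simp add: H_def h')
    fix l :: complex assume l: "l \<in> unit_circle"
    have HD: "H l = D 0 l" using h'(2)[OF l] by (simp add: H_def vec_eq_iff)
    \<comment> \<open>The derivative of \<open>\<Phi>\<close> along the line is computed twice, by
      the product rule and by the differential equation.\<close>
    have "((\<lambda>t. F (z + t *\<^sub>R h) l ** C (z + t *\<^sub>R h) l) has_vector_derivative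
        F (z + 0 *\<^sub>R h) l ** D 0 l + G h (z + 0 *\<^sub>R h) l ** C (z + 0 *\<^sub>R h) l) (at 0)"
      by (rule bounded_bilinear.has_vector_derivative[OF bounded_bilinear_mat2_mult dF dC]) (use \<delta> l in auto)
    then have "((\<lambda>t. \<Phi> (z + t *\<^sub>R h) l) has_vector_derivative F z l ** D 0 l + G h z l ** C z l) (at 0)"
      using \<delta> factor line l
      by (intro has_vector_derivative_transform_within[of _ _ 0 UNIV \<delta> "\<lambda>t. \<Phi> (z + t *\<^sub>R h) l"]) (auto simp: dist_norm)
    then have "F z l ** D 0 l + G h z l ** C z l = \<Phi> z l ** radial_potential k c l z h"
      using d\<Phi>[OF l, of 0] vector_derivative_unique_at by fastforce
    then have "G h z l ** C z l = F z l ** (C z l ** radial_potential k c l z h - H l)"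
      using factor[OF z l] 
      by (simp add: HD matrix_mul_assoc bounded_bilinear.diff_right[OF bounded_bilinear_mat2_mult] eq_diff_eq add.commute)
    then have "adj2 (F z l) ** G h z l ** (C z l ** adj2 (C z l)) =
        adj2 (F z l) ** F z l ** (C z l ** radial_potential k c l z h - H l) ** adj2 (C z l)"
      by (simp add: matrix_mul_assoc) (simp flip: matrix_mul_assoc)
    moreover have "C z l ** adj2 (C z l) = mat 1" using l by (intro adj2_mult_right C_det z) simp
    ultimately show "adj2 (F z l) ** G h z l = (C z l ** radial_potential k c l z h - H l) ** adj2 (C z l)"
      by (simp add: adj2_F[OF z l])
  qed
qed

lemma F_derivative_SU11:
  assumes z: "z \<in> U" and l: "l \<in> unit_circle" and F': "((\<lambda>w. F w l) has_derivative D) (at z)"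
  shows "D h $ 2 $ 2 = cnj (D h $ 1 $ 1)" "D h $ 2 $ 1 = cnj (D h $ 1 $ 2)"
proof -
  have d: "((\<lambda>w. F w l $ i $ j) has_derivative (\<lambda>h. D h $ i $ j)) (at z)" for i j
    by (intro bounded_linear.has_derivative[OF bounded_linear_vec_nth] F')
  have c: "((\<lambda>w. cnj (F w l $ i $ j)) has_derivative (\<lambda>h. cnj (D h $ i $ j))) (at z)" for i j
    by (intro bounded_linear.has_derivative[OF bounded_linear_cnj] d)
  have "((\<lambda>w. F w l $ 2 $ 2) has_derivative (\<lambda>h. cnj (D h $ 1 $ 1))) (at z)"
    by (rule has_derivative_transform_within_open[OF c open_U z]) (use SU11_D(1)[OF F_SU11[OF _ l]] in simp)
  from has_derivative_unique[OF d this] show "D h $ 2 $ 2 = cnj (D h $ 1 $ 1)" by metis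
  have "((\<lambda>w. F w l $ 2 $ 1) has_derivative (\<lambda>h. cnj (D h $ 1 $ 2))) (at z)"
    by (rule has_derivative_transform_within_open[OF c open_U z]) (use SU11_D(2)[OF F_SU11[OF _ l]] in simp)
  from has_derivative_unique[OF d this] show "D h $ 2 $ 1 = cnj (D h $ 1 $ 2)" by metis
qed

text \<open>Matrices with these two relations form a real algebra. It contains
  \<open>adj2 (F z l)\<close>, and also \<open>D h\<close>, because the relations are real
  linear.\<close>

lemma adj2_F_derivative_SU11:
  assumes z: "z \<in> U" and l: "l \<in> unit_circle" and F': "((\<lambda>w. F w l) has_derivative D) (at z)"
  shows "(adj2 (F z l) ** D h) $ 2 $ 2 = cnj ((adj2 (F z l) ** D h) $ 1 $ 1)"
    "(adj2 (F z l) ** D h) $ 2 $ 1 = cnj ((adj2 (F z l) ** D h) $ 1 $ 2)"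
  using F_derivative_SU11[OF assms, of h] SU11_D(1,2)[OF F_SU11[OF z l]]
  by (simp_all add: mat2_mult_nth)

text \<open>Differentiates the relations \<open>C_off\<close> and \<open>C_diag\<close>, which hold
  on all of the open set \<open>U\<close>.\<close>

lemma C_derivative_diag:
  assumes z: "z \<in> U" and d: "\<And>i j. ((\<lambda>t. C (z + t *\<^sub>R h) 0 $ i $ j) has_vector_derivative H $ i $ j) (at 0)"
  shows "H $ 1 $ 2 = 0" "H $ 2 $ 1 = 0" "H $ 2 $ 2 = - H $ 1 $ 1 * (C z 0 $ 2 $ 2)\<^sup>2"
proof -
  have o: "open {t. z + t *\<^sub>R h \<in> U}"
    using continuous_open_vimage[OF open_U, of "\<lambda>t. z + t *\<^sub>R h"]
    by (simp add: vimage_def continuous_intros)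
  have "((\<lambda>t. C (z + t *\<^sub>R h) 0 $ i $ j) has_vector_derivative 0) (at 0)"
    if "\<And>z. z \<in> U \<Longrightarrow> C z 0 $ i $ j = 0" for i j
    by (rule has_vector_derivative_transform_within_open[OF has_vector_derivative_const o]) (use that z in auto)
  then show "H $ 1 $ 2 = 0" "H $ 2 $ 1 = 0"
    using vector_derivative_unique_at[OF d] C_off by metis+
  have "((\<lambda>t. C (z + t *\<^sub>R h) 0 $ 1 $ 1 * C (z + t *\<^sub>R h) 0 $ 2 $ 2) has_vector_derivative 0) (at 0)"
    by (rule has_vector_derivative_transform_within_open[OF has_vector_derivative_const o]) (use C_diag z in auto)
  from vector_derivative_unique_at[OF has_vector_derivative_mult[OF d d] this]
  have "C z 0 $ 1 $ 1 * H $ 2 $ 2 = - (H $ 1 $ 1 * C z 0 $ 2 $ 2)" by (simp add: add_eq_0_iff)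
  then have "C z 0 $ 1 $ 1 * C z 0 $ 2 $ 2 * H $ 2 $ 2 = - H $ 1 $ 1 * (C z 0 $ 2 $ 2)\<^sup>2"
    by algebra
  then show "H $ 2 $ 2 = - H $ 1 $ 1 * (C z 0 $ 2 $ 2)\<^sup>2" by (simp add: C_diag[OF z])
qed

text \<open>The number \<open>w\<close> carries the part of degree 0 in \<open>l\<close>. One value
  serves all loop parameters, so its contributions at \<open>l\<close> and \<open>\<i> * l\<close>
  can cancel in the derivative of the lift.\<close>

definition frame_connection :: "complex \<Rightarrow> complex \<Rightarrow> bool" where
  "frame_connection z w \<longleftrightarrow> (\<forall>l\<in>unit_circle.
     ((\<lambda>\<zeta>. F \<zeta> l) has_derivative (\<lambda>h. F z l ** mc_form (\<beta> z) (\<gamma> z) w l h)) (at z))"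

text \<open>The \<open>dz\<close> coefficient of the Maurer-Cartan form has at most a simple pole in
  \<open>l\<close>, the z-bar coefficient is holomorphic, and the SU(1,1) relations exchange the two
  by conjugation; \<open>disk_algebra_linear\<close> then leaves only terms visible at
  \<open>l = 0\<close>. The last two equations are the Codazzi equations: \<open>w\<close> encodes
  the z-bar derivative of \<open>C z 0\<close>, from which \<open>\<beta>\<close> and
  \<open>\<gamma>\<close> are built.\<close>

lemma frame_equation:
  assumes z: "z \<in> U"
  obtains w \<beta>1 \<beta>2 \<gamma>1 \<gamma>2 where "frame_connection z w"
    "((\<lambda>t. \<beta> (z + t *\<^sub>R 1)) has_vector_derivative \<beta>1) (at 0)"
    "((\<lambda>t. \<beta> (z + t *\<^sub>R \<i>)) has_vector_derivative \<beta>2) (at 0)"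
    "((\<lambda>t. \<gamma> (z + t *\<^sub>R 1)) has_vector_derivative \<gamma>1) (at 0)"
    "((\<lambda>t. \<gamma> (z + t *\<^sub>R \<i>)) has_vector_derivative \<gamma>2) (at 0)"
    "\<beta>1 + \<i> * \<beta>2 = 4 * cnj w * \<beta> z" "\<gamma>1 + \<i> * \<gamma>2 = - 4 * cnj w * \<gamma> z"
proof -
  have "Ck_family (Suc 0) U unit_circle F" using smooth unfolding smooth_family_def by (rule spec)
  then obtain Fx Fy where F': "has_partials U unit_circle F Fx Fy"
    and "Ck_family 0 U unit_circle Fx" "Ck_family 0 U unit_circle Fy"
    unfolding Ck_family_Suc_iff by blast
  then have cont: "continuous_on (U \<times> unit_circle) (\<lambda>(z, l). Fx z l)"
    "continuous_on (U \<times> unit_circle) (\<lambda>(z, l). Fy z l)" by (simp_all only: Ck_family.simps)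
  obtain H1 where H1: "\<And>i j. (\<lambda>l. H1 l $ i $ j) \<in> disk_algebra"
    "\<And>l. l \<in> unit_circle \<Longrightarrow> adj2 (F z l) ** (Re 1 *\<^sub>R Fx z l + Im 1 *\<^sub>R Fy z l) =
       (C z l ** radial_potential k c l z 1 - H1 l) ** adj2 (C z l)"
    "\<And>i j. ((\<lambda>t. C (z + t *\<^sub>R 1) 0 $ i $ j) has_vector_derivative H1 0 $ i $ j) (at 0)"
    by (rule factor_derivative[OF z F' cont, of 1]) blast
  obtain H2 where H2: "\<And>i j. (\<lambda>l. H2 l $ i $ j) \<in> disk_algebra"
    "\<And>l. l \<in> unit_circle \<Longrightarrow> adj2 (F z l) ** (Re \<i> *\<^sub>R Fx z l + Im \<i> *\<^sub>R Fy z l) =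
       (C z l ** radial_potential k c l z \<i> - H2 l) ** adj2 (C z l)"
    "\<And>i j. ((\<lambda>t. C (z + t *\<^sub>R \<i>) 0 $ i $ j) has_vector_derivative H2 0 $ i $ j) (at 0)"
    by (rule factor_derivative[OF z F' cont, of \<i>]) blast
  define N1 where "N1 l = adj2 (F z l) ** Fx z l" for l
  define N2 where "N2 l = adj2 (F z l) ** Fy z l" for l
  \<comment> \<open>\<open>Nz\<close> and \<open>Nz'\<close> are the coefficients of
    \<open>dz\<close> and of its conjugate in the form \<open>N1 dx + N2 dy\<close>.\<close>
  define Nz where "Nz i j l = (N1 l $ i $ j - \<i> * N2 l $ i $ j) / 2" for i j l
  define Nz' where "Nz' i j l = (N1 l $ i $ j + \<i> * N2 l $ i $ j) / 2" for i j l
  \<comment> \<open>The potential conjugated by \<open>C\<close>, freed of its factor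
    \<open>h / l\<close> by taking both \<open>l\<close> and \<open>h\<close> to be 1.\<close>
  define K where "K i j l = (C z l ** radial_potential k c 1 z 1 ** adj2 (C z l)) $ i $ j" for i j l
  define M1 where "M1 i j l = (H1 l ** adj2 (C z l)) $ i $ j" for i j l
  define M2 where "M2 i j l = (H2 l ** adj2 (C z l)) $ i $ j" for i j l
  have adjC: "(\<lambda>l. adj2 (C z l) $ i $ j) \<in> disk_algebra" for i j
    using exhaust_2[of i] exhaust_2[of j] C_disk[OF z] by (elim disjE; simp) (intro disk_algebra_minus C_disk z)+
  have disk: "K i j \<in> disk_algebra" "M1 i j \<in> disk_algebra" "M2 i j \<in> disk_algebra" for i j
    unfolding K_def M1_def M2_def mat2_mult_nth
    by (intro disk_algebra_add disk_algebra_mult disk_algebra_const C_disk z adjC H1(1) H2(1))+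
  have split: "((C z l ** radial_potential k c l z h - H) ** adj2 (C z l)) $ i $ j =
      h / l * K i j l - (H ** adj2 (C z l)) $ i $ j" for l h H i j
    by (simp add: K_def mat2_mult_nth divide_inverse algebra_simps)
  have N: "N1 l $ i $ j = K i j l / l - M1 i j l" "N2 l $ i $ j = \<i> * K i j l / l - M2 i j l"
    if "l \<in> unit_circle" for l i j
    using H1(2)[OF that] H2(2)[OF that] split[of l 1 "H1 l"] split[of l \<i> "H2 l"]
    by (simp_all add: N1_def N2_def M1_def M2_def)
  have su: "N1 l $ 2 $ 2 = cnj (N1 l $ 1 $ 1)" "N1 l $ 2 $ 1 = cnj (N1 l $ 1 $ 2)"
    "N2 l $ 2 $ 2 = cnj (N2 l $ 1 $ 1)" "N2 l $ 2 $ 1 = cnj (N2 l $ 1 $ 2)" if "l \<in> unit_circle" for l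
    using adj2_F_derivative_SU11[OF z that has_partialsD[OF F' z that], of 1]
      adj2_F_derivative_SU11[OF z that has_partialsD[OF F' z that], of \<i>]
    by (simp_all add: N1_def N2_def)
  have conj: "Nz 1 1 l = cnj (Nz' 2 2 l)" "Nz 2 2 l = cnj (Nz' 1 1 l)"
    "Nz 1 2 l = cnj (Nz' 2 1 l)" "Nz 2 1 l = cnj (Nz' 1 2 l)" if "l \<in> unit_circle" for l
    using su[OF that] by (simp_all add: Nz_def Nz'_def)
  \<comment> \<open>The factor \<open>l\<close> clears the pole of \<open>Nz\<close>, while in
    \<open>Nz'\<close> the two terms with \<open>K\<close> cancel. So both agree on the circle with
    members of the disk algebra, as \<open>disk_algebra_linear\<close> demands.\<close>
  have lin: "l * Nz i j l = K i j 0 + l * cnj (- (M1 i' j' 0 + \<i> * M2 i' j' 0) / 2)"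
    if c: "\<And>l. l \<in> unit_circle \<Longrightarrow> Nz i j l = cnj (Nz' i' j' l)" and l: "l \<in> unit_circle" for i j i' j' l
  proof -
    have Nz: "l * Nz i j l = K i j l - l * ((M1 i j l - \<i> * M2 i j l) * (1 / 2))"
      "Nz' i' j' l = - (M1 i' j' l + \<i> * M2 i' j' l) * (1 / 2)" if l: "l \<in> unit_circle" for l
    proof -
      have "l \<noteq> 0" using l by auto
      then show "l * Nz i j l = K i j l - l * ((M1 i j l - \<i> * M2 i j l) * (1 / 2))"
        "Nz' i' j' l = - (M1 i' j' l + \<i> * M2 i' j' l) * (1 / 2)"
        by (simp_all add: Nz_def Nz'_def N[OF l] field_simps)
    qed
    have "K i j l - l * ((M1 i j l - \<i> * M2 i j l) * (1 / 2)) =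
        (K i j 0 - 0 * ((M1 i j 0 - \<i> * M2 i j 0) * (1 / 2))) + l * cnj (- (M1 i' j' 0 + \<i> * M2 i' j' 0) * (1 / 2))"
    proof (rule disk_algebra_linear[OF _ _ _ l])
      show "(\<lambda>l. K i j l - l * ((M1 i j l - \<i> * M2 i j l) * (1 / 2))) \<in> disk_algebra"
        by (intro disk_algebra_diff disk_algebra_mult disk_algebra_id disk_algebra_const disk)
      show "(\<lambda>l. - (M1 i' j' l + \<i> * M2 i' j' l) * (1 / 2)) \<in> disk_algebra"
        by (intro disk_algebra_minus disk_algebra_add disk_algebra_mult disk_algebra_const disk)
      fix l :: complex assume l: "l \<in> unit_circle"
      show "K i j l - l * ((M1 i j l - \<i> * M2 i j l) * (1 / 2)) = l * cnj (- (M1 i' j' l + \<i> * M2 i' j' l) * (1 / 2))"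
        using Nz[OF l] c[OF l] by metis
    qed
    then show ?thesis using Nz(1)[OF l] by simp
  qed
  note off = C_off[OF z] C_derivative_diag[OF z H1(3)] C_derivative_diag[OF z H2(3)]
  define a where "a = C z 0 $ 1 $ 1"
  define d where "d = C z 0 $ 2 $ 2"
  define x1 where "x1 = H1 0 $ 1 $ 1"
  define x2 where "x2 = H2 0 $ 1 $ 1"
  \<comment> \<open>\<open>(x1 + \<i> * x2) / 2\<close> is the z-bar derivative of the entry
    \<open>a\<close>, and \<open>d = 1 / a\<close>; so \<open>w\<close> is the conjugate of the
    logarithmic z-bar derivative of \<open>a\<close>.\<close>
  define w where "w = cnj ((x1 + \<i> * x2) * d / 2)"
  have ad: "a * d = 1" using C_diag[OF z] by (simp add: a_def d_def)
  have K0: "K 1 1 0 = 0" "K 2 2 0 = 0" "K 1 2 0 = \<beta> z" "K 2 1 0 = \<gamma> z"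
    by (simp_all add: K_def mat2_mult_nth off \<beta>_def \<gamma>_def power2_eq_square)
  have M0: "M1 1 2 0 = 0" "M1 2 1 0 = 0" "M2 1 2 0 = 0" "M2 2 1 0 = 0"
    "M1 1 1 0 = x1 * d" "M2 1 1 0 = x2 * d" "M1 2 2 0 = - x1 * d * (a * d)" "M2 2 2 0 = - x2 * d * (a * d)"
    by (simp_all add: M1_def M2_def mat2_mult_nth off a_def d_def x1_def x2_def power2_eq_square)
  have Nz: "Nz 1 1 l = w" "Nz 2 2 l = - w" "Nz 1 2 l = \<beta> z * cnj l" "Nz 2 1 l = \<gamma> z * cnj l"
    if l: "l \<in> unit_circle" for l
  proof -
    have l0: "l \<noteq> 0" and ll: "l * cnj l = 1" using l by (auto simp flip: complex_norm_square)
    have "l * Nz 1 1 l = l * w" "l * Nz 2 2 l = l * (- w)"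
    proof -
      have "cnj (- (M1 1 1 0 + \<i> * M2 1 1 0) / 2) = - w" "cnj (- (M1 2 2 0 + \<i> * M2 2 2 0) / 2) = w"
        by (simp_all add: M0 ad w_def field_simps)
      then show "l * Nz 1 1 l = l * w" "l * Nz 2 2 l = l * (- w)"
        using lin[OF conj(1) l] lin[OF conj(2) l] K0 by simp_all
    qed
    then show "Nz 1 1 l = w" "Nz 2 2 l = - w" using l0 mult_left_cancel by blast+
    have "l * Nz 1 2 l = l * (\<beta> z * cnj l)" "l * Nz 2 1 l = l * (\<gamma> z * cnj l)"
      using lin[OF conj(3) l] lin[OF conj(4) l] ll by (simp_all add: K0 M0 algebra_simps)
    then show "Nz 1 2 l = \<beta> z * cnj l" "Nz 2 1 l = \<gamma> z * cnj l" using l0 by simp_all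
  qed
  have N12: "N1 l $ i $ j = Nz i j l + Nz' i j l" "N2 l $ i $ j = \<i> * (Nz i j l - Nz' i j l)" for i j l
    by (simp_all add: Nz_def Nz'_def field_simps)
  have mc: "mc_form (\<beta> z) (\<gamma> z) w l h = Re h *\<^sub>R N1 l + Im h *\<^sub>R N2 l" if l: "l \<in> unit_circle" for l h
  proof -
    have "Nz' 1 1 l = - cnj w" "Nz' 2 2 l = cnj w" "Nz' 2 1 l = cnj (\<beta> z) * l" "Nz' 1 2 l = cnj (\<gamma> z) * l"
      using conj[OF l] Nz[OF l] by (metis complex_cnj_cnj complex_cnj_minus complex_cnj_mult)+
    then have "mc_form (\<beta> z) (\<gamma> z) w l (of_real s + \<i> * of_real t) = s *\<^sub>R N1 l + t *\<^sub>R N2 l" for s t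
      by (simp add: mat2_eq_iff mat2_scaleR_nth N12 Nz[OF l] mc_coeff_def algebra_simps
          del: vector_scaleR_component)
    then show ?thesis by (metis complex_eq)
  qed
  have pow: "((\<lambda>t. (z + t *\<^sub>R h) ^ k) has_vector_derivative of_nat k * z ^ (k - 1) * h) (at 0)" for h
    by (rule has_vector_derivative_line[where f = "\<lambda>z. z ^ k"])
      (auto intro!: derivative_eq_intros simp: algebra_simps)
  have \<beta>': "((\<lambda>t. \<beta> (z + t *\<^sub>R h)) has_vector_derivative 2 * a * H $ 1 $ 1) (at 0)"
    and \<gamma>': "((\<lambda>t. \<gamma> (z + t *\<^sub>R h)) has_vector_derivative
      c * z ^ k * (2 * d * H $ 2 $ 2) + c * (of_nat k * z ^ (k - 1) * h) * d\<^sup>2) (at 0)"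
    if "\<And>i j. ((\<lambda>t. C (z + t *\<^sub>R h) 0 $ i $ j) has_vector_derivative H $ i $ j) (at 0)" for h H
  proof -
    have sq: "((\<lambda>t. (C (z + t *\<^sub>R h) 0 $ i $ i)\<^sup>2) has_vector_derivative 2 * C z 0 $ i $ i * H $ i $ i) (at 0)" for i
      using has_vector_derivative_mult[OF that[of i i] that[of i i]] by (simp add: power2_eq_square mult_ac)
    show "((\<lambda>t. \<beta> (z + t *\<^sub>R h)) has_vector_derivative 2 * a * H $ 1 $ 1) (at 0)"
      using sq[of 1] by (simp add: \<beta>_def a_def)
    show "((\<lambda>t. \<gamma> (z + t *\<^sub>R h)) has_vector_derivative
      c * z ^ k * (2 * d * H $ 2 $ 2) + c * (of_nat k * z ^ (k - 1) * h) * d\<^sup>2) (at 0)"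
      using has_vector_derivative_mult[OF has_vector_derivative_mult[OF has_vector_derivative_const[of c] pow] sq[of 2]]
      by (simp add: \<gamma>_def d_def)
  qed
  show thesis
  proof (rule that[OF _ \<beta>'[OF H1(3)] \<beta>'[OF H2(3)] \<gamma>'[OF H1(3)] \<gamma>'[OF H2(3)]])
    have "F z l ** N1 l = Fx z l" "F z l ** N2 l = Fy z l" if l: "l \<in> unit_circle" for l
      by (simp_all add: N1_def N2_def matrix_mul_assoc adj2_F[OF z l])
    then have F: "F z l ** mc_form (\<beta> z) (\<gamma> z) w l h = Re h *\<^sub>R Fx z l + Im h *\<^sub>R Fy z l"
      if l: "l \<in> unit_circle" for h l
      using l by (simp add: mc[OF l] bounded_bilinear.add_right[OF bounded_bilinear_mat2_mult]
          bounded_bilinear.scaleR_right[OF bounded_bilinear_mat2_mult])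
    show "frame_connection z w"
      unfolding frame_connection_def
    proof
      fix l :: complex assume l: "l \<in> unit_circle"
      show "((\<lambda>\<zeta>. F \<zeta> l) has_derivative (\<lambda>h. F z l ** mc_form (\<beta> z) (\<gamma> z) w l h)) (at z)"
        unfolding F[OF l] by (rule has_partialsD[OF F' z l])
    qed
  next
    \<comment> \<open>The left side is twice the z-bar derivative of \<open>\<beta>\<close>, the
      square of \<open>a\<close>, and \<open>cnj w\<close> is the logarithmic z-bar derivative of
      \<open>a\<close>.\<close>
    have "2 * a * x1 + \<i> * (2 * a * x2) = 4 * cnj w * a\<^sup>2"
      using ad by (simp add: w_def) algebra
    then show "2 * a * H1 0 $ 1 $ 1 + \<i> * (2 * a * H2 0 $ 1 $ 1) = 4 * cnj w * \<beta> z"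
      by (simp add: x1_def x2_def \<beta>_def a_def)
    \<comment> \<open>The terms from differentiating \<open>z ^ k\<close> cancel because
      \<open>1 + \<i> * \<i> = 0\<close>, that is, because \<open>z ^ k\<close> is
      holomorphic.\<close>
    show "c * z ^ k * (2 * d * H1 0 $ 2 $ 2) + c * (of_nat k * z ^ (k - 1) * 1) * d\<^sup>2 +
        \<i> * (c * z ^ k * (2 * d * H2 0 $ 2 $ 2) + c * (of_nat k * z ^ (k - 1) * \<i>) * d\<^sup>2) = - 4 * cnj w * \<gamma> z"
      by (simp add: off w_def x1_def[symmetric] x2_def[symmetric] d_def[symmetric] \<gamma>_def power2_eq_square algebra_simps)
  qed
qed

section \<open>Rotated frames and the frame at the base point\<close>

text \<open>The rotation law of the solution yields a second Iwasawa factorization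
  \<open>F' ** C'\<close> at the rotated point. The transition matrix \<open>M\<close> between the
  two is SU(1,1)-valued and extends to the disk, hence constant; at the centre it is diagonal, and
  its entries have modulus 1.\<close>

lemma frame_rotate:
  assumes z: "z \<in> U" and z': "cis \<theta> * z \<in> U"
  obtains \<tau> where "norm \<tau> = 1" "norm (C (cis \<theta> * z) 0 $ 1 $ 1) = norm (C z 0 $ 1 $ 1)"
    "\<And>l. l \<in> unit_circle \<Longrightarrow> F (cis \<theta> * z) l =
       diag_conj (cis (- real k * \<theta> / 2)) (F z (l * cis (- (real k + 2) * \<theta> / 2))) **
       vector [vector [\<tau>, 0], vector [0, cnj \<tau>]]"
proof -
  define \<delta> where "\<delta> = cis (- real k * \<theta> / 2)"
  define \<kappa> where "\<kappa> = cis (- (real k + 2) * \<theta> / 2)"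
  define F' where "F' l = diag_conj \<delta> (F z (l * \<kappa>))" for l
  define C' where "C' l = diag_conj \<delta> (C z (\<kappa> * l))" for l
  have \<delta>: "\<delta> \<noteq> 0" "norm \<delta> = 1" and \<kappa>: "norm \<kappa> = 1" by (simp_all add: \<delta>_def \<kappa>_def)
  have circle: "l * \<kappa> \<in> unit_circle" if "l \<in> unit_circle" for l
    using that \<kappa> by (simp add: norm_mult)
  have F': "F' l \<in> SU11" if "l \<in> unit_circle" for l
    unfolding F'_def by (intro SU11_diag_conj F_SU11 z circle that \<delta>)
  have detC': "det (C' l) = 1" if "l \<in> cball 0 1" for l
    unfolding C'_def det_diag_conj[OF \<delta>(1)] using that \<kappa> by (intro C_det z) (simp add: norm_mult)
  have eq: "F (cis \<theta> * z) l ** C (cis \<theta> * z) l = F' l ** C' l" if l: "l \<in> unit_circle" for l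
  proof -
    have "diag_conj (cis (real k * \<theta> / 2)) (\<Phi> (cis \<theta> * z) l) = \<Phi> z (l * \<kappa>)"
      using l by (intro radial_solution_rotate[OF solution solution] circle) (auto simp: \<kappa>_def)
    then have "diag_conj \<delta> (diag_conj (cis (real k * \<theta> / 2)) (\<Phi> (cis \<theta> * z) l)) =
        diag_conj \<delta> (F z (l * \<kappa>) ** C z (l * \<kappa>))"
      using factor[OF z circle[OF l]] by simp
    moreover have "diag_conj \<delta> (diag_conj (cis (real k * \<theta> / 2)) A) = A" for A
      by (simp add: mat2_eq_iff \<delta>_def cis_mult flip: mult.assoc)
    ultimately show ?thesis
      using factor[OF z' l] by (simp add: diag_conj_mult[OF \<delta>(1)] F'_def C'_def mult.commute)
  qed
  define M where "M l = C (cis \<theta> * z) l ** adj2 (C' l)" for l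
  have M: "M l = adj2 (F (cis \<theta> * z) l) ** F' l" if l: "l \<in> unit_circle" for l
  proof -
    have "M l = adj2 (F (cis \<theta> * z) l) ** (F (cis \<theta> * z) l ** C (cis \<theta> * z) l) ** adj2 (C' l)"
      by (simp add: M_def matrix_mul_assoc adj2_F[OF z' l])
    also have "\<dots> = adj2 (F (cis \<theta> * z) l) ** F' l ** (C' l ** adj2 (C' l))"
      by (simp add: eq[OF l] matrix_mul_assoc)
    also have "C' l ** adj2 (C' l) = mat 1" using l by (intro adj2_mult_right detC') simp
    finally show ?thesis by simp
  qed
  have const: "M l = M 0" "M 0 \<in> SU11" if l: "l \<in> unit_circle" for l
  proof -
    have C'_disk: "(\<lambda>l. adj2 (C' l) $ i $ j) \<in> disk_algebra" for i j
    proof -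
      have "(\<lambda>l. C z (\<kappa> * l) $ i $ j) \<in> disk_algebra" for i j
        by (rule disk_algebra_rotate[OF C_disk[OF z] \<kappa>])
      then have "(\<lambda>l. C' l $ i $ j) \<in> disk_algebra" for i j
        using exhaust_2[of i] exhaust_2[of j]
        by (elim disjE; simp add: C'_def divide_inverse) (intro disk_algebra_mult disk_algebra_const; simp)+
      then show ?thesis
        using exhaust_2[of i] exhaust_2[of j] by (elim disjE; simp) (intro disk_algebra_minus; simp)+
    qed
    have "(\<lambda>l. M l $ i $ j) \<in> disk_algebra" for i j
      unfolding M_def mat2_mult_nth
      by (intro disk_algebra_add disk_algebra_mult C_disk z' C'_disk)
    moreover have SU: "M l \<in> SU11" if "l \<in> unit_circle" for l
      unfolding M[OF that] by (intro SU11_mult SU11_adj2 F_SU11 z' that F')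
    ultimately show "M l = M 0" using l by (rule SU11_disk_algebra_const)
    then show "M 0 \<in> SU11" using SU[OF l] by simp
  qed
  define m where "m = M 0 $ 1 $ 1"
  \<comment> \<open>At the centre both plus factors are diagonal and the gauge leaves diagonal
    entries alone, so \<open>m\<close> is the quotient of the two upper left entries of
    \<open>C\<close>.\<close>
  have off: "M 0 $ 1 $ 2 = 0" "M 0 $ 2 $ 1 = 0" and m: "m = C (cis \<theta> * z) 0 $ 1 $ 1 * C z 0 $ 2 $ 2"
    by (simp_all add: M_def m_def C'_def mat2_mult_nth C_off z z')
  have "M 0 \<in> SU11" using const(2)[of 1] by simp
  note M0 = SU11_D[OF this, folded m_def]
  have mm: "m * cnj m = 1" using M0(3) off by simp
  then have nm: "norm m = 1"
    by (metis complex_norm_square norm_ge_zero norm_one of_real_1 of_real_eq_iff one_power2 power2_eq_imp_eq zero_le_one)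
  show thesis
  proof (rule that[of "cnj m"])
    show "norm (cnj m) = 1" using nm by simp
    have "norm (C z 0 $ 1 $ 1) * norm (C z 0 $ 2 $ 2) = 1"
      using C_diag[OF z] by (metis norm_mult norm_one)
    moreover have "norm (C (cis \<theta> * z) 0 $ 1 $ 1) * norm (C z 0 $ 2 $ 2) = 1"
      using nm m by (metis norm_mult)
    ultimately show "norm (C (cis \<theta> * z) 0 $ 1 $ 1) = norm (C z 0 $ 1 $ 1)"
      by (metis mult_cancel_right mult_zero_right zero_neq_one)
    fix l :: complex assume l: "l \<in> unit_circle"
    have "F (cis \<theta> * z) l ** M 0 = F' l"
      using M[OF l] const(1)[OF l] by (metis adj2_F(2)[OF z' l] matrix_mul_assoc matrix_mul_lid)
    then have "F (cis \<theta> * z) l ** (M 0 ** adj2 (M 0)) = F' l ** adj2 (M 0)"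
      by (simp add: matrix_mul_assoc)
    then have "F (cis \<theta> * z) l = F' l ** adj2 (M 0)"
      by (simp add: adj2_mult_right[OF M0(4)])
    moreover have "adj2 (M 0) = vector [vector [cnj m, 0], vector [0, cnj (cnj m)]]"
      by (simp add: mat2_eq_iff off M0(1) flip: m_def)
    ultimately show "F (cis \<theta> * z) l = diag_conj (cis (- real k * \<theta> / 2)) (F z (l * cis (- (real k + 2) * \<theta> / 2))) **
       vector [vector [cnj m, 0], vector [0, cnj (cnj m)]]"
      by (simp add: F'_def \<delta>_def \<kappa>_def)
  qed
qed

text \<open>At the base point the solution is the identity, so \<open>F\<close> is the inverse of
  the plus factor and constant in \<open>l\<close>. This locates the surface at the base point of
  \<open>Q2star\<close>.\<close>

lemma frame_origin:
  assumes "0 \<in> U"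
  obtains \<tau> where "norm \<tau> = 1" "\<And>l. l \<in> unit_circle \<Longrightarrow> F 0 l = vector [vector [\<tau>, 0], vector [0, cnj \<tau>]]"
proof -
  have F: "F 0 l = adj2 (C 0 l)" if l: "l \<in> unit_circle" for l
  proof -
    have "F 0 l ** (C 0 l ** adj2 (C 0 l)) = adj2 (C 0 l)"
      using solution[OF l] factor[OF assms l] by (simp add: radial_solution_def matrix_mul_assoc)
    moreover have "C 0 l ** adj2 (C 0 l) = mat 1" using l by (intro adj2_mult_right C_det assms) simp
    ultimately show ?thesis by simp
  qed
  have "(\<lambda>l. adj2 (C 0 l) $ i $ j) \<in> disk_algebra" for i j
    using exhaust_2[of i] exhaust_2[of j] C_disk[OF assms]
    by (elim disjE; simp) (intro disk_algebra_minus C_disk assms)+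
  then have const: "adj2 (C 0 l) = adj2 (C 0 0)" if "l \<in> unit_circle" for l
    by (rule SU11_disk_algebra_const[OF _ _ that]) (simp flip: F add: F_SU11 assms)
  have SU: "adj2 (C 0 0) \<in> SU11"
    using F[of 1] F_SU11[OF assms, of 1] const[of 1] by simp
  define \<tau> where "\<tau> = C 0 0 $ 2 $ 2"
  have d: "adj2 (C 0 0) = vector [vector [\<tau>, 0], vector [0, cnj \<tau>]]"
    using SU11_D(1)[OF SU] by (simp add: mat2_eq_iff C_off assms \<tau>_def)
  have "\<tau> * cnj \<tau> = 1" using SU11_D(3)[OF SU] by (simp add: \<tau>_def C_off assms)
  then have "norm \<tau> = 1"
    by (metis complex_norm_square norm_ge_zero norm_one of_real_1 of_real_eq_iff one_power2 power2_eq_imp_eq zero_le_one)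
  then show thesis using that[of \<tau>] F const d by simp
qed

end

section \<open>The Segre map\<close>

text \<open>
  In the isotropic coordinates of the form \<open>bil\<close>, the quadric is the image of the Segre embedding;
  the constants are chosen such that the lift of the surface is the tensor product of the
  second column of the frame at \<open>l\<close> and its first column at \<open>\<i> * l\<close>.
\<close>

definition tens :: "complex ^ 2 \<Rightarrow> complex ^ 2 \<Rightarrow> vec4" where
  "tens x y = complex_of_real (1 / sqrt 2) *s vector
     [x $ 2 * y $ 1 - x $ 1 * y $ 2, \<i> * (x $ 2 * y $ 1 + x $ 1 * y $ 2),
      x $ 1 * y $ 1 - x $ 2 * y $ 2, \<i> * (x $ 1 * y $ 1 + x $ 2 * y $ 2)]"

text \<open>The Hermitian form of signature (1,1) that SU(1,1) preserves.\<close>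

definition form2 :: "complex ^ 2 \<Rightarrow> complex ^ 2 \<Rightarrow> complex" where
  "form2 x y = x $ 1 * cnj (y $ 1) - x $ 2 * cnj (y $ 2)"

lemma vec4_eq_iff: "(v :: vec4) = w \<longleftrightarrow> v $ 1 = w $ 1 \<and> v $ 2 = w $ 2 \<and> v $ 3 = w $ 3 \<and> v $ 4 = w $ 4"
  by (simp add: vec_eq_iff forall_4)

lemma vec2_eq_iff: "(v :: complex ^ 2) = w \<longleftrightarrow> v $ 1 = w $ 1 \<and> v $ 2 = w $ 2"
  by (simp add: vec_eq_iff forall_2)

lemma tens_nth:
  "tens x y $ 1 = complex_of_real (1 / sqrt 2) * (x $ 2 * y $ 1 - x $ 1 * y $ 2)"
  "tens x y $ 2 = complex_of_real (1 / sqrt 2) * (\<i> * (x $ 2 * y $ 1 + x $ 1 * y $ 2))"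
  "tens x y $ 3 = complex_of_real (1 / sqrt 2) * (x $ 1 * y $ 1 - x $ 2 * y $ 2)"
  "tens x y $ 4 = complex_of_real (1 / sqrt 2) * (\<i> * (x $ 1 * y $ 1 + x $ 2 * y $ 2))"
  by (simp_all only: tens_def vector_smult_component vector_4)

lemma half_square: "complex_of_real (1 / sqrt 2) * complex_of_real (1 / sqrt 2) = 1 / 2"
  by (simp flip: of_real_mult)

lemma tens_add: "tens (x + x') y = tens x y + tens x' y" "tens x (y + y') = tens x y + tens x y'"
  by (simp_all add: vec4_eq_iff tens_nth algebra_simps)

lemma tens_smult: "tens (a *s x) y = a *s tens x y" "tens x (a *s y) = a *s tens x y"
  by (simp_all add: vec4_eq_iff tens_nth algebra_simps)

lemma scaleR_eq_smult: "r *\<^sub>R (v :: complex ^ 'n) = complex_of_real r *s v"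
  by (simp add: vec_eq_iff scaleR_conv_of_real[of r "v $ _"])

lemma bounded_bilinear_tens: "bounded_bilinear tens"
  unfolding bilinear_conv_bounded_bilinear[symmetric] bilinear_def
  by (auto intro!: linearI simp: tens_add tens_smult scaleR_eq_smult)

lemma bounded_bilinear_smult: "bounded_bilinear ((*s) :: complex \<Rightarrow> complex ^ 'n \<Rightarrow> complex ^ 'n)"
  unfolding bilinear_conv_bounded_bilinear[symmetric] bilinear_def
  by (auto intro!: linearI simp: scaleR_eq_smult scaleR_conv_of_real[where ?'a = complex] vec_eq_iff algebra_simps)

lemma bounded_linear_smult: "bounded_linear (\<lambda>v :: complex ^ 'n. a *s v)"
  by (rule bounded_bilinear.bounded_linear_right[OF bounded_bilinear_smult])

lemma bounded_linear_column: "bounded_linear (column j :: mat2 \<Rightarrow> _)"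
  unfolding linear_conv_bounded_linear[symmetric] by (auto intro!: linearI simp: vec_eq_iff column_def)

lemma column_nth [simp]: "column j A $ i = A $ i $ j"
  by (simp add: column_def)

lemma column_mult: "column j (A ** M) = M $ 1 $ j *s column 1 A + M $ 2 $ j *s column 2 (A :: mat2)"
  by (simp add: vec2_eq_iff mat2_mult_nth mult.commute)

text \<open>Reduces every inner product on the surface to the pseudo-orthonormality of the columns
  of the frame.\<close>

lemma herm_tens: "herm (tens x y) (tens x' y') = form2 x x' * form2 y y'"
proof -
  have r: "(of_real r * a) * cnj (of_real r * b) = (of_real r * of_real r) * (a * cnj b)" for r a b
    by simp
  have s: "(complex_of_real (1 / sqrt 2) * a) * cnj (complex_of_real (1 / sqrt 2) * b) = (1 / 2) * (a * cnj b)" for a b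
    unfolding r half_square ..
  have half: "- (1 / 2 * a) - 1 / 2 * b + 1 / 2 * c + 1 / 2 * d = 1 / 2 * (- a - b + c + d)" for a b c d :: complex
    by (simp add: algebra_simps)
  have "herm (tens x y) (tens x' y') = - (tens x y $ 1 * cnj (tens x' y' $ 1)) - tens x y $ 2 * cnj (tens x' y' $ 2) +
      tens x y $ 3 * cnj (tens x' y' $ 3) + tens x y $ 4 * cnj (tens x' y' $ 4)"
    by (simp add: herm_def bil_def cnj_vec_def)
  then show ?thesis
    unfolding tens_nth s half by (simp add: form2_def algebra_simps)
qed

text \<open>In these coordinates \<open>bil v v\<close> is -2 times the determinant of the matrix of
  products \<open>x $ i * y $ j\<close>, which has rank at most 1.\<close>

lemma bil_tens_self: "bil (tens x y) (tens x y) = 0"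
  by (simp add: bil_def tens_nth algebra_simps)

lemma herm_add: "herm (u + v) w = herm u w + herm v w" "herm u (v + w) = herm u v + herm u w"
  by (simp_all add: herm_def bil_def cnj_vec_def algebra_simps)

lemma herm_diff: "herm (u - v) w = herm u w - herm v w"
  by (simp add: herm_def bil_def cnj_vec_def algebra_simps)

lemma herm_smult: "herm (a *s u) v = a * herm u v" "herm u (a *s v) = cnj a * herm u v"
  by (simp_all add: herm_def bil_def cnj_vec_def algebra_simps)

lemma bil_smult: "bil (a *s u) (b *s v) = a * b * bil u v"
  by (simp add: bil_def algebra_simps)

lemma form2_columns:
  assumes "A \<in> SU11"
  shows "form2 (column 1 A) (column 1 A) = 1" "form2 (column 2 A) (column 2 A) = - 1"
    "form2 (column 1 A) (column 2 A) = 0" "form2 (column 2 A) (column 1 A) = 0"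
  using SU11_D[OF assms] by (simp_all add: form2_def algebra_simps)

text \<open>Conjugating one column of an SU(1,1) matrix gives the other column with its entries
  swapped; swapping in both factors and conjugating the constants \<open>\<i>\<close> changes
  \<open>tens\<close> by a sign.\<close>

lemma cnj_vec_tens:
  assumes "A \<in> SU11" "B \<in> SU11"
  shows "cnj_vec (tens (column 2 A) (column 1 B)) = - tens (column 1 A) (column 2 B)"
  using SU11_D(1,2)[OF assms(1)] SU11_D(1,2)[OF assms(2)]
  by (simp add: vec4_eq_iff cnj_vec_def tens_nth algebra_simps)

lemma surface_lift_eq_tens:
  assumes "F z l \<in> SU11" "F z (\<i> * l) \<in> SU11"
  shows "surface_lift F l z = tens (column 2 (F z l)) (column 1 (F z (\<i> * l)))"
proof -
  define A where "A = F z l"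
  define B where "B = F z (\<i> * l)"
  have inv: "matrix_inv B = adj2 B"
    using assms(2) unfolding B_def by (intro matrix_inv_det_1 SU11_D)
  have "frame_X F l z = A ** adj2 B" "frame_Y F l z = map_matrix (\<lambda>a. \<i> * a) (A ** sigma3 ** adj2 B)"
    using inv by (simp_all add: frame_X_def frame_Y_def A_def B_def)
  then have X: "frame_X F l z $ 1 $ 1 = A $ 1 $ 1 * cnj (B $ 1 $ 1) - A $ 1 $ 2 * cnj (B $ 1 $ 2)"
    "frame_X F l z $ 2 $ 1 = cnj (A $ 1 $ 2) * cnj (B $ 1 $ 1) - cnj (A $ 1 $ 1) * cnj (B $ 1 $ 2)"
    "frame_Y F l z $ 1 $ 1 = \<i> * (A $ 1 $ 1 * cnj (B $ 1 $ 1) + A $ 1 $ 2 * cnj (B $ 1 $ 2))"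
    "frame_Y F l z $ 2 $ 1 = \<i> * (cnj (A $ 1 $ 2) * cnj (B $ 1 $ 1) + cnj (A $ 1 $ 1) * cnj (B $ 1 $ 2))"
    using SU11_D(1,2)[OF assms(1)] SU11_D(1,2)[OF assms(2)]
    by (simp_all add: mat2_mult_nth map_matrix_def A_def B_def)
  \<comment> \<open>The entries of \<open>X\<close> and \<open>Y\<close> are the difference and
    \<open>\<i>\<close> times the sum of the same two products; pairing their real or imaginary
    parts conjugates only the first product.\<close>
  have C: "Complex (Re (a - b)) (Re (\<i> * (a + b))) = cnj a - b"
    "Complex (Im (a - b)) (Im (\<i> * (a + b))) = \<i> * (cnj a + b)" for a b
    by (simp_all add: complex_eq_iff)
  show ?thesis
    unfolding surface_lift_def Let_def X C tens_def column_nth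
    using SU11_D(1,2)[OF assms(1)] SU11_D(1,2)[OF assms(2)] by (simp add: A_def B_def)
qed

section \<open>Second derivatives\<close>

lemma deriv_dir_eqI: "(f has_derivative D) (at z) \<Longrightarrow> deriv_dir f z h = D h"
  unfolding deriv_dir_def by (simp flip: frechet_derivative_at)

text \<open>Smoothness provides the Frechet derivative of \<open>deriv_dir f\<close>, so its value
  can be read off from a derivative along a single line.\<close>

lemma deriv_dir_deriv_dir:
  assumes U: "open U" and f: "smooth_map U f" and z: "z \<in> U"
    and S: "((\<lambda>t. deriv_dir f (z + t *\<^sub>R h) h') has_vector_derivative S) (at 0)"
  shows "deriv_dir (\<lambda>z. deriv_dir f z h') z h = S"
proof -
  have "Ck_family (Suc (Suc 0)) U {0 :: nat} (\<lambda>z p. f z)"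
    using f unfolding smooth_map_def smooth_family_def by (rule spec)
  then obtain fx fy where f': "has_partials U {0 :: nat} (\<lambda>z p. f z) fx fy"
    and "Ck_family (Suc 0) U {0 :: nat} fx" "Ck_family (Suc 0) U {0 :: nat} fy"
    unfolding Ck_family_Suc_iff[of "Suc 0"] by blast
  then obtain fxx fxy fyx fyy where f'': "has_partials U {0 :: nat} fx fxx fxy" "has_partials U {0 :: nat} fy fyx fyy"
    unfolding Ck_family_Suc_iff[of 0] by blast
  have eq: "Re h' *\<^sub>R fx w 0 + Im h' *\<^sub>R fy w 0 = deriv_dir f w h'" if "w \<in> U" for w
    using deriv_dir_eqI[OF has_partialsD[OF f' that]] by simp
  define D where "D k = Re h' *\<^sub>R (Re k *\<^sub>R fxx z 0 + Im k *\<^sub>R fxy z 0) + Im h' *\<^sub>R (Re k *\<^sub>R fyx z 0 + Im k *\<^sub>R fyy z 0)" for k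
  have "((\<lambda>w. Re h' *\<^sub>R fx w 0 + Im h' *\<^sub>R fy w 0) has_derivative D) (at z)"
    unfolding D_def
    by (intro has_derivative_add has_derivative_scaleR_right has_partialsD[OF f''(1) z] has_partialsD[OF f''(2) z]) auto
  then have D: "((\<lambda>w. deriv_dir f w h') has_derivative D) (at z)"
    by (rule has_derivative_transform_within_open[OF _ U z]) (rule eq)
  then have "((\<lambda>t. deriv_dir f (z + t *\<^sub>R h) h') has_vector_derivative D h) (at 0)"
    by (intro has_vector_derivative_line) simp
  then have "D h = S" using S by (rule vector_derivative_unique_at)
  then show ?thesis using deriv_dir_eqI[OF D] by simp
qed

section \<open>Geometry of the surface\<close>

context radial_frame
begin

abbreviation mc :: "complex \<Rightarrow> complex \<Rightarrow> complex \<Rightarrow> complex" where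
  "mc z \<equiv> mc_coeff (\<beta> z) (\<gamma> z)"

text \<open>A moving pseudo-orthonormal frame of the flat space: up to phase the indices 2 1 give
  the lift, 1 1 and 2 2 contain its derivatives in their span, and 1 2 gives the conjugate of the
  lift.\<close>

definition lift_ij :: "2 \<Rightarrow> 2 \<Rightarrow> complex \<Rightarrow> complex \<Rightarrow> vec4" where
  "lift_ij i j l z = tens (column i (F z l)) (column j (F z (\<i> * l)))"

lemma i_circle: "l \<in> unit_circle \<Longrightarrow> \<i> * l \<in> unit_circle"
  by (simp add: norm_mult)

lemma surface_lift_eq: "z \<in> U \<Longrightarrow> l \<in> unit_circle \<Longrightarrow> surface_lift F l z = lift_ij 2 1 l z"
  unfolding lift_ij_def by (intro surface_lift_eq_tens F_SU11 i_circle)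

lemma smooth_lift:
  assumes "l \<in> unit_circle"
  shows "smooth_map U (\<lambda>z. \<omega> *s surface_lift F l z)"
  unfolding smooth_map_def smooth_family_def
proof
  fix n
  have F: "Ck_family n U {0 :: nat} (\<lambda>z p. F z l)" if "l \<in> unit_circle" for l
    using Ck_family_at_param[OF that] smooth unfolding smooth_family_def by blast
  have *: "Ck_family n U {0 :: nat} (\<lambda>z p. \<omega> *s tens (column 2 (F z l)) (column 1 (F z (\<i> * l))))"
    by (intro Ck_family_linear[OF bounded_linear_smult] Ck_family_bilinear[OF bounded_bilinear_tens]
        Ck_family_linear[OF bounded_linear_column] F assms i_circle)
  show "Ck_family n U {0 :: nat} (\<lambda>z p. \<omega> *s surface_lift F l z)"
  proof (rule Ck_family_cong[OF open_U _ *])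
    show "\<omega> *s tens (column 2 (F z l)) (column 1 (F z (\<i> * l))) = \<omega> *s surface_lift F l z" if "z \<in> U" for z
      by (simp only: surface_lift_eq[OF that assms] lift_ij_def)
  qed
qed

lemma herm_lift_ij:
  assumes "z \<in> U" "l \<in> unit_circle"
  shows "herm (lift_ij i j l z) (lift_ij i' j' l z) =
    (if i = i' \<and> j = j' then if i = j then 1 else - 1 else 0)"
  unfolding lift_ij_def herm_tens
  using form2_columns[OF F_SU11[OF assms]] form2_columns[OF F_SU11[OF assms(1) i_circle[OF assms(2)]]]
    exhaust_2[of i] exhaust_2[of j] exhaust_2[of i'] exhaust_2[of j'] by auto

lemma column_derivative:
  assumes w: "frame_connection z w" and l: "l \<in> unit_circle"
  shows "((\<lambda>\<zeta>. column 1 (F \<zeta> l)) has_derivative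
      (\<lambda>h. (h * w - cnj (h * w)) *s column 1 (F z l) + cnj (mc z l h) *s column 2 (F z l))) (at z)"
    "((\<lambda>\<zeta>. column 2 (F \<zeta> l)) has_derivative
      (\<lambda>h. mc z l h *s column 1 (F z l) + (cnj (h * w) - h * w) *s column 2 (F z l))) (at z)"
proof -
  have F': "((\<lambda>\<zeta>. F \<zeta> l) has_derivative (\<lambda>h. F z l ** mc_form (\<beta> z) (\<gamma> z) w l h)) (at z)"
    using w l unfolding frame_connection_def by (rule bspec)
  from bounded_linear.has_derivative[OF bounded_linear_column[of 1] F']
  show "((\<lambda>\<zeta>. column 1 (F \<zeta> l)) has_derivative
      (\<lambda>h. (h * w - cnj (h * w)) *s column 1 (F z l) + cnj (mc z l h) *s column 2 (F z l))) (at z)"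
    by (simp only: column_mult mc_form_nth)
  from bounded_linear.has_derivative[OF bounded_linear_column[of 2] F']
  show "((\<lambda>\<zeta>. column 2 (F \<zeta> l)) has_derivative
      (\<lambda>h. mc z l h *s column 1 (F z l) + (cnj (h * w) - h * w) *s column 2 (F z l))) (at z)"
    by (simp only: column_mult mc_form_nth)
qed

text \<open>The terms with \<open>w\<close> cancel: they enter the two columns with opposite signs
  and do not depend on the loop parameter. Hence the derivative has no component along the
  lift.\<close>

lemma lift_derivative:
  assumes z: "z \<in> U" and l: "l \<in> unit_circle"
  shows "((\<lambda>\<zeta>. \<omega> *s surface_lift F l \<zeta>) has_derivative
    (\<lambda>h. \<omega> *s (mc z l h *s lift_ij 1 1 l z + cnj (mc z (\<i> * l) h) *s lift_ij 2 2 l z))) (at z)"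
proof -
  obtain w where w: "frame_connection z w"
    by (rule frame_equation[OF z]) (rule that)
  have "((\<lambda>\<zeta>. \<omega> *s tens (column 2 (F \<zeta> l)) (column 1 (F \<zeta> (\<i> * l)))) has_derivative
    (\<lambda>h. \<omega> *s (tens (column 2 (F z l)) ((h * w - cnj (h * w)) *s column 1 (F z (\<i> * l)) + cnj (mc z (\<i> * l) h) *s column 2 (F z (\<i> * l))) +
      tens (mc z l h *s column 1 (F z l) + (cnj (h * w) - h * w) *s column 2 (F z l)) (column 1 (F z (\<i> * l)))))) (at z)"
    by (intro bounded_linear.has_derivative[OF bounded_linear_smult]
        bounded_bilinear.FDERIV[OF bounded_bilinear_tens] column_derivative w l i_circle)
  moreover have "tens (column 2 (F z l)) ((h * w - cnj (h * w)) *s column 1 (F z (\<i> * l)) + cnj (mc z (\<i> * l) h) *s column 2 (F z (\<i> * l))) +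
      tens (mc z l h *s column 1 (F z l) + (cnj (h * w) - h * w) *s column 2 (F z l)) (column 1 (F z (\<i> * l))) =
      mc z l h *s lift_ij 1 1 l z + cnj (mc z (\<i> * l) h) *s lift_ij 2 2 l z" for h
    by (simp only: tens_add tens_smult lift_ij_def) (simp add: vec4_eq_iff algebra_simps)
  ultimately have "((\<lambda>\<zeta>. \<omega> *s lift_ij 2 1 l \<zeta>) has_derivative
    (\<lambda>h. \<omega> *s (mc z l h *s lift_ij 1 1 l z + cnj (mc z (\<i> * l) h) *s lift_ij 2 2 l z))) (at z)"
    by (simp only: lift_ij_def[of 2 1])
  then show ?thesis
    by (rule has_derivative_transform_within_open[OF _ open_U z]) (simp only: surface_lift_eq l)
qed

lemmas deriv_lift = deriv_dir_eqI[OF lift_derivative]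

definition conformal_factor :: "complex \<Rightarrow> real" where
  "conformal_factor z = 2 * ((norm (\<beta> z))\<^sup>2 + (norm (\<gamma> z))\<^sup>2)"

lemma conformal_factor_pos: "z \<in> U \<Longrightarrow> conformal_factor z > 0"
  using C_diag[of z] by (auto simp: conformal_factor_def \<beta>_def intro!: add_pos_nonneg)

text \<open>The mixed terms in \<open>\<beta>\<close> and \<open>\<gamma>\<close> carry the square
  of \<open>l\<close> or of \<open>cnj l\<close>, so they change sign from \<open>l\<close> to
  \<open>\<i> * l\<close> and cancel. The remaining terms occur with their conjugates; the product
  is real, which gives both the Lagrangian property and conformality.\<close>

lemma herm_deriv_lift:
  assumes z: "z \<in> U" and l: "l \<in> unit_circle" and \<omega>: "\<omega> \<in> unit_circle"
  defines "f \<equiv> \<lambda>z. \<omega> *s surface_lift F l z"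
  shows "herm (deriv_dir f z h) (f z) = 0"
    "herm (f z) (f z) = - 1"
    "herm (deriv_dir f z h) (deriv_dir f z h') = of_real (conformal_factor z * Re (h * cnj h'))"
proof -
  have \<omega>1: "\<omega> * cnj \<omega> = 1"
    using \<omega> by (simp flip: complex_norm_square)
  have fz: "f z = \<omega> *s lift_ij 2 1 l z" unfolding f_def by (simp only: surface_lift_eq[OF z l])
  note d = deriv_lift[OF z l, of \<omega>, folded f_def] and h = herm_lift_ij[OF z l]
  show "herm (deriv_dir f z h) (f z) = 0" "herm (f z) (f z) = - 1"
    using \<omega>1 by (simp_all add: d fz herm_add herm_smult h mult.commute)
  have "herm (deriv_dir f z h) (deriv_dir f z h') = (\<omega> * cnj \<omega>) *
      (mc z l h * cnj (mc z l h') + cnj (mc z (\<i> * l) h) * mc z (\<i> * l) h')"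
    by (simp add: d herm_add herm_smult h algebra_simps)
  also have "\<dots> = (l * cnj l) * ((\<beta> z * cnj (\<beta> z) + \<gamma> z * cnj (\<gamma> z)) * (h * cnj h' + cnj (h * cnj h')))"
    by (simp add: \<omega>1 mc_coeff_def algebra_simps)
  also have "h * cnj h' + cnj (h * cnj h') = of_real (2 * Re (h * cnj h'))"
    by (simp only: complex_add_cnj)
  finally show "herm (deriv_dir f z h) (deriv_dir f z h') = of_real (conformal_factor z * Re (h * cnj h'))"
    using l by (simp add: conformal_factor_def algebra_simps flip: complex_norm_square)
qed

lemma cnj_vec_lift: "z \<in> U \<Longrightarrow> l \<in> unit_circle \<Longrightarrow> cnj_vec (lift_ij 2 1 l z) = - lift_ij 1 2 l z"
  unfolding lift_ij_def by (intro cnj_vec_tens F_SU11 i_circle)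

lemma has_vector_derivative_line0:
  "(f has_derivative f') (at z) \<Longrightarrow> ((\<lambda>t. f (z + t *\<^sub>R h)) has_vector_derivative f' h) (at 0)"
  using has_vector_derivative_line[of f f' z 0 h] by simp

text \<open>The tangential terms cancel because of the Codazzi equations for \<open>\<beta>\<close> and \<open>\<gamma>\<close>.\<close>

lemma laplacian_lift:
  fixes \<omega> :: complex
  assumes z: "z \<in> U" and l: "l \<in> unit_circle"
  defines "f \<equiv> \<lambda>z. \<omega> *s surface_lift F l z"
  obtains a b where "deriv_x (deriv_x f) z + deriv_y (deriv_y f) z = \<omega> *s (a *s lift_ij 2 1 l z + b *s lift_ij 1 2 l z)"
proof -
  obtain w \<beta>1 \<beta>2 \<gamma>1 \<gamma>2 where w: "frame_connection z w"
    and d1: "((\<lambda>t. \<beta> (z + t *\<^sub>R 1)) has_vector_derivative \<beta>1) (at 0)"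
      "((\<lambda>t. \<gamma> (z + t *\<^sub>R 1)) has_vector_derivative \<gamma>1) (at 0)"
    and d2: "((\<lambda>t. \<beta> (z + t *\<^sub>R \<i>)) has_vector_derivative \<beta>2) (at 0)"
      "((\<lambda>t. \<gamma> (z + t *\<^sub>R \<i>)) has_vector_derivative \<gamma>2) (at 0)"
    and cod: "\<beta>1 + \<i> * \<beta>2 = 4 * cnj w * \<beta> z" "\<gamma>1 + \<i> * \<gamma>2 = - 4 * cnj w * \<gamma> z"
    by (rule frame_equation[OF z]) (rule that)
  define v where "v h = h * w - cnj (h * w)" for h
  let ?A = "\<lambda>h. mc z l h" and ?B = "\<lambda>h. mc z (\<i> * l) h"
  \<comment> \<open>The second derivative in direction \<open>h\<close>, expanded in the moving
    frame; \<open>\<beta>'\<close> and \<open>\<gamma>'\<close> stand for the derivatives of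
    \<open>\<beta>\<close> and \<open>\<gamma>\<close> along \<open>h\<close>.\<close>
  define S where "S h \<beta>' \<gamma>' = \<omega> *s (
      (mc_coeff \<beta>' \<gamma>' l h + 2 * v h * ?A h) *s lift_ij 1 1 l z +
      (cnj (mc_coeff \<beta>' \<gamma>' (\<i> * l) h) - 2 * v h * cnj (?B h)) *s lift_ij 2 2 l z +
      (?A h * cnj (?A h) + ?B h * cnj (?B h)) *s lift_ij 2 1 l z + (2 * ?A h * cnj (?B h)) *s lift_ij 1 2 l z)" for h \<beta>' \<gamma>'
  have second: "deriv_dir (\<lambda>z. deriv_dir f z h) z h = S h \<beta>' \<gamma>'"
    if \<beta>': "((\<lambda>t. \<beta> (z + t *\<^sub>R h)) has_vector_derivative \<beta>') (at 0)"
      and \<gamma>': "((\<lambda>t. \<gamma> (z + t *\<^sub>R h)) has_vector_derivative \<gamma>') (at 0)" for h \<beta>' \<gamma>'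
  proof (rule deriv_dir_deriv_dir[OF open_U _ z])
    show "smooth_map U f" unfolding f_def by (rule smooth_lift[OF l])
    have A: "((\<lambda>t. mc (z + t *\<^sub>R h) \<mu> h) has_vector_derivative mc_coeff \<beta>' \<gamma>' \<mu> h) (at 0)" for \<mu>
      unfolding mc_coeff_def
      by (intro has_vector_derivative_add has_vector_derivative_mult_left has_vector_derivative_mult_right
          has_vector_derivative_cnj \<beta>' \<gamma>')
    have c1: "((\<lambda>t. column 1 (F (z + t *\<^sub>R h) \<mu>)) has_vector_derivative
        v h *s column 1 (F z \<mu>) + cnj (mc z \<mu> h) *s column 2 (F z \<mu>)) (at 0)"
      if "\<mu> \<in> unit_circle" for \<mu>
      unfolding v_def by (rule has_vector_derivative_line0[OF column_derivative(1)[OF w that]])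
    have c2: "((\<lambda>t. column 2 (F (z + t *\<^sub>R h) \<mu>)) has_vector_derivative
        mc z \<mu> h *s column 1 (F z \<mu>) + (- v h) *s column 2 (F z \<mu>)) (at 0)"
      if "\<mu> \<in> unit_circle" for \<mu>
      unfolding v_def minus_diff_eq by (rule has_vector_derivative_line0[OF column_derivative(2)[OF w that]])
    have P: "((\<lambda>t. lift_ij 1 1 l (z + t *\<^sub>R h)) has_vector_derivative
        (2 * v h) *s lift_ij 1 1 l z + (cnj (?A h) *s lift_ij 2 1 l z + cnj (?B h) *s lift_ij 1 2 l z)) (at 0)"
      unfolding lift_ij_def
      by (rule has_vector_derivative_eq_rhs[OF bounded_bilinear.has_vector_derivative[OF bounded_bilinear_tens c1[OF l] c1[OF i_circle[OF l]]]])
        (simp only: tens_add tens_smult scaleR_zero_left add_0_right, simp add: vec4_eq_iff algebra_simps)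
    have Q: "((\<lambda>t. lift_ij 2 2 l (z + t *\<^sub>R h)) has_vector_derivative
        (- 2 * v h) *s lift_ij 2 2 l z + (?A h *s lift_ij 1 2 l z + ?B h *s lift_ij 2 1 l z)) (at 0)"
      unfolding lift_ij_def
      by (rule has_vector_derivative_eq_rhs[OF bounded_bilinear.has_vector_derivative[OF bounded_bilinear_tens c2[OF l] c2[OF i_circle[OF l]]]])
        (simp only: tens_add tens_smult scaleR_zero_left add_0_right, simp add: vec4_eq_iff algebra_simps)
    have "((\<lambda>t. \<omega> *s (mc (z + t *\<^sub>R h) l h *s lift_ij 1 1 l (z + t *\<^sub>R h) +
          cnj (mc (z + t *\<^sub>R h) (\<i> * l) h) *s lift_ij 2 2 l (z + t *\<^sub>R h))) has_vector_derivative S h \<beta>' \<gamma>') (at 0)"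
      by (rule has_vector_derivative_eq_rhs[OF bounded_linear.has_vector_derivative[OF bounded_linear_smult
            has_vector_derivative_add[OF
              bounded_bilinear.has_vector_derivative[OF bounded_bilinear_smult A P]
              bounded_bilinear.has_vector_derivative[OF bounded_bilinear_smult has_vector_derivative_cnj[OF A] Q]]]])
        (simp add: S_def vec4_eq_iff algebra_simps)
    moreover have "open {t. z + t *\<^sub>R h \<in> U}"
      using continuous_open_vimage[OF open_U, of "\<lambda>t. z + t *\<^sub>R h"]
      by (simp add: vimage_def continuous_intros)
    ultimately show "((\<lambda>t. deriv_dir f (z + t *\<^sub>R h) h) has_vector_derivative S h \<beta>' \<gamma>') (at 0)"
      by (rule has_vector_derivative_transform_within_open)
        (use z l in \<open>auto simp: f_def deriv_lift simp del: mem_sphere mem_sphere_0\<close>)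
  qed
  \<comment> \<open>Summed over the directions 1 and \<open>\<i>\<close>, the coefficients of the
    tangential vectors become combinations of the Codazzi expressions in \<open>cod\<close> and
    their conjugates.\<close>
  have P: "mc_coeff \<beta>1 \<gamma>1 l 1 + 2 * v 1 * ?A 1 + (mc_coeff \<beta>2 \<gamma>2 l \<i> + 2 * v \<i> * ?A \<i>) =
      cnj l * (\<beta>1 + \<i> * \<beta>2 - 4 * cnj w * \<beta> z) + l * cnj (\<gamma>1 + \<i> * \<gamma>2 + 4 * cnj w * \<gamma> z)"
    by (simp add: mc_coeff_def v_def algebra_simps)
  have Q: "cnj (mc_coeff \<beta>1 \<gamma>1 (\<i> * l) 1) - 2 * v 1 * cnj (?B 1) + (cnj (mc_coeff \<beta>2 \<gamma>2 (\<i> * l) \<i>) - 2 * v \<i> * cnj (?B \<i>)) =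
      \<i> * l * cnj (\<beta>1 + \<i> * \<beta>2 - 4 * cnj w * \<beta> z) - \<i> * cnj l * (\<gamma>1 + \<i> * \<gamma>2 + 4 * cnj w * \<gamma> z)"
    by (simp add: mc_coeff_def v_def algebra_simps)
  have "deriv_x (deriv_x f) z + deriv_y (deriv_y f) z = S 1 \<beta>1 \<gamma>1 + S \<i> \<beta>2 \<gamma>2"
    using second[OF d1] second[OF d2] by simp
  also have "\<dots> = \<omega> *s (
      (mc_coeff \<beta>1 \<gamma>1 l 1 + 2 * v 1 * ?A 1 + (mc_coeff \<beta>2 \<gamma>2 l \<i> + 2 * v \<i> * ?A \<i>)) *s lift_ij 1 1 l z +
      (cnj (mc_coeff \<beta>1 \<gamma>1 (\<i> * l) 1) - 2 * v 1 * cnj (?B 1) + (cnj (mc_coeff \<beta>2 \<gamma>2 (\<i> * l) \<i>) - 2 * v \<i> * cnj (?B \<i>))) *s lift_ij 2 2 l z +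
      ((?A 1 * cnj (?A 1) + ?B 1 * cnj (?B 1) + (?A \<i> * cnj (?A \<i>) + ?B \<i> * cnj (?B \<i>))) *s lift_ij 2 1 l z +
       (2 * ?A 1 * cnj (?B 1) + 2 * ?A \<i> * cnj (?B \<i>)) *s lift_ij 1 2 l z))"
    unfolding S_def by (simp add: vec4_eq_iff algebra_simps)
  also have "\<dots> = \<omega> *s (
      (?A 1 * cnj (?A 1) + ?B 1 * cnj (?B 1) + (?A \<i> * cnj (?A \<i>) + ?B \<i> * cnj (?B \<i>))) *s lift_ij 2 1 l z +
       (2 * ?A 1 * cnj (?B 1) + 2 * ?A \<i> * cnj (?B \<i>)) *s lift_ij 1 2 l z)"
    unfolding P Q cod by simp
  finally show thesis by (rule that)
qed

end

section \<open>The projective quadric\<close>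

lemma proj_self: "v \<in> proj v"
  unfolding proj_def by (auto intro!: exI[of _ 1])

lemma proj_nonzero: "v \<noteq> 0 \<Longrightarrow> w \<in> proj v \<Longrightarrow> w \<noteq> 0"
  by (auto simp: proj_def)

lemma topspace_CP3: "proj ` (- {0}) \<subseteq> topspace CP3"
proof (rule openin_subset)
  have "\<Union> (proj ` (- {0})) = - {0}"
    using proj_self proj_nonzero by blast
  then show "openin CP3 (proj ` (- {0}))" by (simp add: openin_CP3 open_Compl[OF closed_singleton])
qed

lemma continuous_map_proj:
  assumes "continuous_on U f" "\<And>z. z \<in> U \<Longrightarrow> f z \<noteq> 0"
  shows "continuous_map (top_of_set U) CP3 (\<lambda>z. proj (f z))"
  unfolding continuous_map_def
proof (intro conjI allI impI)
  show "(\<lambda>z. proj (f z)) \<in> topspace (top_of_set U) \<rightarrow> topspace CP3"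
    using assms(2) topspace_CP3 by auto
  fix S assume S: "openin CP3 S"
  \<comment> \<open>Members of \<open>S\<close> are whole punctured lines, so a line belongs to
    \<open>S\<close> as soon as one of its vectors lies in the union.\<close>
  have "proj (f z) \<in> S \<longleftrightarrow> f z \<in> \<Union> S" for z
  proof
    assume "f z \<in> \<Union> S"
    then obtain p where p: "p \<in> S" "f z \<in> p" by blast
    then obtain v where "p = proj v" using S by (auto simp: openin_CP3)
    then show "proj (f z) \<in> S" using p proj_cases by metis
  qed (use proj_self in blast)
  then have "{z \<in> topspace (top_of_set U). proj (f z) \<in> S} = U \<inter> f -` \<Union> S" by auto
  moreover have "open (\<Union> S)" using S by (simp add: openin_CP3)
  ultimately show "openin (top_of_set U) {z \<in> topspace (top_of_set U). proj (f z) \<in> S}"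
    using continuous_openin_preimage_gen[OF assms(1)] by simp
qed

text \<open>\<open>Q2star\<close> is a connected component, so it contains the continuous image of a
  connected set once this image lies in the quadric and meets the base point.\<close>

lemma connected_image_in_Q2star:
  assumes conn: "connected U" and cont: "continuous_on U f"
    and quadric: "\<And>z. z \<in> U \<Longrightarrow> herm (f z) (f z) = - 1" "\<And>z. z \<in> U \<Longrightarrow> bil (f z) (f z) = 0"
    and z0: "z0 \<in> U" "proj (f z0) = proj (vector [1, \<i>, 0, 0])" and z: "z \<in> U"
  shows "proj (f z) \<in> Q2star"
proof -
  let ?S = "{p \<in> CH31. \<forall>v\<in>p. bil v v = 0}"
  have "proj (f z) \<in> ?S" if "z \<in> U" for z
  proof -
    have "proj (f z) \<in> CH31" using quadric(1)[OF that] by (force simp: CH31_def)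
    moreover have "bil v v = 0" if v: "v \<in> proj (f z)" for v
      using v quadric(2)[OF \<open>z \<in> U\<close>] by (auto simp: proj_def bil_smult)
    ultimately show ?thesis by blast
  qed
  moreover have "f z \<noteq> 0" if "z \<in> U" for z
    using quadric(1)[OF that] by (auto simp: herm_def bil_def)
  ultimately have "continuous_map (top_of_set U) (subtopology CP3 ?S) (\<lambda>z. proj (f z))"
    using continuous_map_proj[OF cont] by (auto simp: continuous_map_in_subtopology)
  then have "connectedin (subtopology CP3 ?S) ((\<lambda>z. proj (f z)) ` U)"
    by (rule connectedin_continuous_map_image) (use conn in \<open>simp add: connectedin_subtopology\<close>)
  then have "connected_component_of (subtopology CP3 ?S) (proj (f z0)) (proj (f z))"
    using z z0(1) unfolding connected_component_of_def by blast
  then show ?thesis using z0(2) by (simp add: Q2star_def)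
qed

lemma induced_metric_horizontal:
  assumes "\<And>h. herm (deriv_dir f z h) (f z) = 0"
  shows "induced_metric f z v w = Re (herm (deriv_dir f z v) (deriv_dir f z w))"
    "induced_kaehler_form f z v w = Re (\<i> * herm (deriv_dir f z v) (deriv_dir f z w))"
  by (simp_all add: induced_metric_def induced_kaehler_form_def horizontal_part_def assms herm_smult)

section \<open>Minimality, radial metric and symmetry\<close>

context radial_frame
begin

lemma minimal_lagrangian_lift:
  assumes conn: "connected U" and 0: "0 \<in> U" and l: "l \<in> unit_circle" and \<omega>: "\<omega> \<in> unit_circle"
  defines "f \<equiv> \<lambda>z. \<omega> *s surface_lift F l z"
  shows "minimal_lagrangian_Q2star U (\<lambda>z. proj (f z)) f"
    and induced_metric_lift: "z \<in> U \<Longrightarrow> induced_metric f z v w = conformal_factor z * Re (v * cnj w)"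
proof -
  have herm: "herm (deriv_dir f z h) (f z) = 0" "herm (f z) (f z) = - 1"
    "herm (deriv_dir f z h) (deriv_dir f z h') = of_real (conformal_factor z * Re (h * cnj h'))"
    if "z \<in> U" for z h h'
    unfolding f_def by (rule herm_deriv_lift[OF that l \<omega>])+
  have fz: "f z = \<omega> *s lift_ij 2 1 l z" if "z \<in> U" for z
    unfolding f_def by (simp only: surface_lift_eq[OF that l])
  have \<omega>1: "\<omega> * cnj \<omega> = 1" using \<omega> by (simp flip: complex_norm_square)
  have smooth: "smooth_map U f" unfolding f_def by (rule smooth_lift[OF l])
  have cont: "continuous_on U f"
  proof (rule continuous_at_imp_continuous_on, rule ballI)
    show "isCont f z" if "z \<in> U" for z
      unfolding f_def by (rule has_derivative_continuous[OF lift_derivative[OF that l]])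
  qed
  have bil: "bil (f z) (f z) = 0" if "z \<in> U" for z
    by (simp add: fz[OF that] bil_smult lift_ij_def bil_tens_self)
  \<comment> \<open>At 0 the frame is the same diagonal matrix for all loop parameters; its phases
    \<open>cnj \<tau>\<close> and \<open>\<tau>\<close> cancel in the tensor product.\<close>
  have origin: "proj (f 0) = proj (vector [1, \<i>, 0, 0])"
  proof (rule proj_cases)
    obtain \<tau> where \<tau>: "norm \<tau> = 1" "\<And>l. l \<in> unit_circle \<Longrightarrow> F 0 l = vector [vector [\<tau>, 0], vector [0, cnj \<tau>]]"
      by (rule frame_origin[OF 0]) (rule that)
    have "cnj \<tau> * \<tau> = 1" using \<tau>(1) by (metis complex_norm_square mult.commute of_real_1 one_power2)
    then have "f 0 = (\<omega> * complex_of_real (1 / sqrt 2)) *s vector [1, \<i>, 0, 0]"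
      unfolding fz[OF 0] lift_ij_def \<tau>(2)[OF l] \<tau>(2)[OF i_circle[OF l]]
      by (simp add: vec4_eq_iff tens_nth)
    moreover have "\<omega> * complex_of_real (1 / sqrt 2) \<noteq> 0" using \<omega> by auto
    ultimately show "f 0 \<in> proj (vector [1, \<i>, 0, 0])" unfolding proj_def by blast
  qed
  have Q: "proj (f z) \<in> Q2star" if "z \<in> U" for z
    by (rule connected_image_in_Q2star[OF conn cont herm(2) bil 0 origin that])
  show metric: "induced_metric f z v w = conformal_factor z * Re (v * cnj w)" if "z \<in> U" for z v w
    by (simp only: induced_metric_horizontal(1)[OF herm(1)[OF that]] herm(3)[OF that] Re_complex_of_real)
  have kaehler: "induced_kaehler_form f z v w = 0" if "z \<in> U" for z v w
    unfolding induced_metric_horizontal(2)[OF herm(1)[OF that]] herm(3)[OF that] by simp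
  have positive: "induced_metric f z v v > 0" if "z \<in> U" "v \<noteq> 0" for z v
  proof -
    have "Re (v * cnj v) = (norm v)\<^sup>2" by (metis Re_complex_of_real complex_norm_square)
    then show ?thesis using conformal_factor_pos[OF that(1)] that(2) by (simp only: metric[OF that(1)]) simp
  qed
  have horizontal: "bil (wirtinger_z f z) (cnj_vec (f z)) = 0" "bil (wirtinger_zbar f z) (cnj_vec (f z)) = 0"
    if "z \<in> U" for z
    unfolding herm_def[symmetric] wirtinger_z_def wirtinger_zbar_def herm_smult herm_diff herm_add herm(1)[OF that]
    by simp_all
  have mean: "mean_curvature_vanishes f z" if z: "z \<in> U" for z
  proof -
    obtain a b where ab: "deriv_x (deriv_x f) z + deriv_y (deriv_y f) z = \<omega> *s (a *s lift_ij 2 1 l z + b *s lift_ij 1 2 l z)"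
      using laplacian_lift[OF z l] unfolding f_def by metis
    \<comment> \<open>Conjugating the lift conjugates its phase as well, and the factor
      \<open>\<omega>\<close> undoes this.\<close>
    have R: "lift_ij 1 2 l z = - (\<omega> *s cnj_vec (f z))"
    proof -
      have "cnj_vec (f z) = cnj \<omega> *s cnj_vec (lift_ij 2 1 l z)"
        by (simp add: fz[OF z] cnj_vec_def vec_eq_iff)
      then have "\<omega> *s cnj_vec (f z) = (\<omega> * cnj \<omega>) *s cnj_vec (lift_ij 2 1 l z)"
        by (simp add: vector_smult_assoc)
      then show ?thesis using cnj_vec_lift[OF z l] by (simp add: \<omega>1)
    qed
    let ?E = "conformal_factor z"
    \<comment> \<open>For a conformal metric the mixed term drops out and the trace is the conformal
      factor times the Laplacian, which \<open>laplacian_lift\<close> places in the span of the lift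
      and its conjugate.\<close>
    have "induced_metric f z \<i> \<i> *\<^sub>R deriv_x (deriv_x f) z
        - (2 * induced_metric f z 1 \<i>) *\<^sub>R deriv_x (deriv_y f) z
        + induced_metric f z 1 1 *\<^sub>R deriv_y (deriv_y f) z =
        of_real ?E *s (deriv_x (deriv_x f) z + deriv_y (deriv_y f) z)"
      unfolding metric[OF z] scaleR_eq_smult by (simp add: vector_add_ldistrib)
    also have "\<dots> = (of_real ?E * a) *s f z + (- (of_real ?E * b * \<omega> * \<omega>)) *s cnj_vec (f z) +
        (0::real) *\<^sub>R deriv_x f z + (0::real) *\<^sub>R deriv_y f z"
      unfolding ab R fz[OF z] by (simp add: vec4_eq_iff algebra_simps)
    finally show ?thesis unfolding mean_curvature_vanishes_def by blast
  qed
  show "minimal_lagrangian_Q2star U (\<lambda>z. proj (f z)) f"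
    unfolding minimal_lagrangian_Q2star_def horizontal_lift_def is_lift_def H73_def
    using smooth herm(2) horizontal Q positive kaehler mean by auto
qed

text \<open>\<open>frame_rotate\<close> preserves the modulus of the upper left entry of
  \<open>C\<close> at the centre, \<open>C_diag\<close> then that of the lower right one, and the
  factor \<open>z ^ k\<close> in \<open>\<gamma>\<close> keeps its modulus.\<close>

lemma conformal_factor_rotate:
  assumes "z \<in> U" "cis \<theta> * z \<in> U"
  shows "conformal_factor (cis \<theta> * z) = conformal_factor z"
proof -
  have C: "norm (C (cis \<theta> * z) 0 $ 1 $ 1) = norm (C z 0 $ 1 $ 1)"
    by (rule frame_rotate[OF assms]) blast
  have inv: "norm (C z 0 $ 2 $ 2) = 1 / norm (C z 0 $ 1 $ 1)" if "z \<in> U" for z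
  proof -
    have "norm (C z 0 $ 1 $ 1) * norm (C z 0 $ 2 $ 2) = 1"
      using C_diag[OF that] by (metis norm_mult norm_one)
    then show ?thesis by (metis mult_zero_left nonzero_mult_div_cancel_left zero_neq_one)
  qed
  show ?thesis
    by (simp add: conformal_factor_def \<beta>_def \<gamma>_def norm_mult norm_power C inv[OF assms(1)] inv[OF assms(2)])
qed

lemma conformal_factor_radial:
  obtains \<rho> where "\<And>z. z \<in> U \<Longrightarrow> conformal_factor z = \<rho> (norm z)"
proof
  \<comment> \<open>A representative in \<open>U\<close> for each radius that occurs.
    \<open>U\<close> need not be invariant under rotations, so only points inside it are
    compared.\<close>
  define pick where "pick r = (SOME z. z \<in> U \<and> norm z = r)" for r
  fix z assume z: "z \<in> U"
  then have p: "pick (norm z) \<in> U" "norm (pick (norm z)) = norm z"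
    unfolding pick_def using someI[of "\<lambda>w. w \<in> U \<and> norm w = norm z" z] by auto
  show "conformal_factor z = conformal_factor (pick (norm z))"
  proof (cases "z = 0")
    case True
    then show ?thesis using p(2) by simp
  next
    case False
    then have "norm (z / pick (norm z)) = 1" using p(2) by (simp add: norm_divide)
    then obtain \<theta> where "z / pick (norm z) = cis \<theta>"
      by (metis cis_conv_exp complex_norm_eq_1_exp)
    moreover have "pick (norm z) \<noteq> 0" using p(2) False by auto
    ultimately have "z = cis \<theta> * pick (norm z)" by (simp add: field_simps)
    then show ?thesis using conformal_factor_rotate[OF p(1), of \<theta>] z by metis
  qed
qed

text \<open>The reflected point is \<open>cnj z\<close> rotated by \<open>\<theta>\<close>, which
  turns the loop parameter by the sign \<open>(- 1) ^ m\<close>; the twisting converts this sign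
  into a gauge. The total gauge multiplies one entry of each tensor factor by opposite phases, which
  fixes the first two coordinates of \<open>tens\<close> and rotates the last two.\<close>

lemma lift_symmetry:
  assumes z: "cnj z \<in> U" and z': "reflection k m z \<in> U" and l: "l \<in> unit_circle"
  shows "surface_lift F l (reflection k m z) = symmetry_matrix k m *v surface_lift F l (cnj z)"
proof -
  define \<theta> where "\<theta> = 2 * pi * real m / real (k + 2)"
  have refl: "reflection k m z = cis \<theta> * cnj z"
    by (simp add: reflection_def \<theta>_def cis_conv_exp mult_ac)
  have turn: "- (real k + 2) * \<theta> / 2 = - (real m * pi)"
  proof -
    have "- N * (2 * x / N) / 2 = - x" if "N \<noteq> 0" for N x :: real using that by simp
    from this[of "real (k + 2)" "real m * pi"] show ?thesis by (simp add: \<theta>_def mult_ac add.commute)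
  qed
  have sgn: "cis (- (real k + 2) * \<theta> / 2) = (- 1) ^ m"
  proof -
    have "cis (- pi) = - 1" by (simp add: complex_eq_iff)
    then show ?thesis unfolding turn using Complex.DeMoivre[of "- pi" m] by simp
  qed
  obtain \<tau> where \<tau>: "norm \<tau> = 1" and F: "\<And>l. l \<in> unit_circle \<Longrightarrow> F (cis \<theta> * cnj z) l =
       diag_conj (cis (- real k * \<theta> / 2)) (F (cnj z) (l * cis (- (real k + 2) * \<theta> / 2))) **
       vector [vector [\<tau>, 0], vector [0, cnj \<tau>]]"
    by (rule frame_rotate[OF z z'[unfolded refl]]) (rule that)
  \<comment> \<open>Conjugation by \<open>sigma3\<close> is \<open>diag_conj (- 1)\<close>, so the
    twisting is needed only for odd \<open>m\<close>.\<close>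
  have twist: "F (cnj z) (l * (- 1) ^ m) = diag_conj ((- 1) ^ m) (F (cnj z) l)" if "l \<in> unit_circle" for l
    using F_twist[OF z that] by (cases "even m") (simp_all add: mat2_eq_iff mat2_mult_nth)
  \<comment> \<open>The two gauges combine because \<open>- k * \<theta> / 2\<close> differs from
    \<open>\<theta>\<close> by the turn of the loop parameter, whose \<open>cis\<close> is the sign
    \<open>(- 1) ^ m\<close>.\<close>
  have \<epsilon>: "cis (- real k * \<theta> / 2) * (- 1) ^ m = cis \<theta>"
  proof -
    have "- real k * \<theta> / 2 = \<theta> + - (real k + 2) * \<theta> / 2" by (simp add: field_simps)
    then have "cis (- real k * \<theta> / 2) = cis \<theta> * (- 1) ^ m" by (simp only: cis_mult[symmetric] sgn)
    then show ?thesis by (simp flip: power_mult_distrib)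
  qed
  have dd: "diag_conj a (diag_conj b A) = diag_conj (a * b) A" for a b A
    by (simp add: mat2_eq_iff mult_ac)
  have F': "F (cis \<theta> * cnj z) l = diag_conj (cis \<theta>) (F (cnj z) l) ** vector [vector [\<tau>, 0], vector [0, cnj \<tau>]]"
    if "l \<in> unit_circle" for l
    unfolding F[OF that] sgn twist[OF that] dd \<epsilon> ..
  have c2: "column 2 (F (cis \<theta> * cnj z) l) = cnj \<tau> *s vector [cis \<theta> * F (cnj z) l $ 1 $ 2, F (cnj z) l $ 2 $ 2]"
    if "l \<in> unit_circle" for l
    by (simp add: F'[OF that] vec2_eq_iff mat2_mult_nth)
  have c1: "column 1 (F (cis \<theta> * cnj z) l) = \<tau> *s vector [F (cnj z) l $ 1 $ 1, F (cnj z) l $ 2 $ 1 / cis \<theta>]"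
    if "l \<in> unit_circle" for l
    by (simp add: F'[OF that] vec2_eq_iff mat2_mult_nth)
  have \<tau>1: "\<tau> * cnj \<tau> = 1" using \<tau> by (simp flip: complex_norm_square)
  define x where "x = column 2 (F (cnj z) l)"
  define y where "y = column 1 (F (cnj z) (\<i> * l))"
  have "surface_lift F l (reflection k m z) = (\<tau> * cnj \<tau>) *s tens (vector [cis \<theta> * x $ 1, x $ 2]) (vector [y $ 1, y $ 2 / cis \<theta>])"
    unfolding refl surface_lift_eq[OF z'[unfolded refl] l] lift_ij_def c2[OF l] c1[OF i_circle[OF l]] tens_smult
    by (simp add: vector_smult_assoc x_def y_def)
  also have "\<dots> = tens (vector [cis \<theta> * x $ 1, x $ 2]) (vector [y $ 1, cis (- \<theta>) * y $ 2])"
    by (simp add: \<tau>1 divide_inverse cis_inverse mult.commute)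
  also have "\<dots> = symmetry_matrix k m *v tens x y"
  proof -
    have S: "symmetry_matrix k m *v v = vector [v $ 1, v $ 2,
        of_real (cos \<theta>) * v $ 3 + of_real (sin \<theta>) * v $ 4, - of_real (sin \<theta>) * v $ 3 + of_real (cos \<theta>) * v $ 4]" for v
      by (simp add: symmetry_matrix_def Let_def \<theta>_def vec4_eq_iff matrix_vector_mult_def sum_4 map_matrix_def)
    have e: "cis \<theta> = of_real (cos \<theta>) + \<i> * of_real (sin \<theta>)" "cis (- \<theta>) = of_real (cos \<theta>) - \<i> * of_real (sin \<theta>)"
      by (simp_all add: complex_eq_iff)
    have one: "cis \<theta> * cis (- \<theta>) = 1" by (simp add: cis_mult)
    \<comment> \<open>These are the products of one entry of each phase; they make up the first two
      coordinates of the tensor.\<close>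
    have "cis \<theta> * a * (cis (- \<theta>) * b) = a * b" for a b
      using one by (metis mult.assoc mult.left_commute mult_1)
    then show ?thesis
      unfolding S by (simp add: vec4_eq_iff tens_nth) (simp add: e algebra_simps add_divide_distrib diff_divide_distrib)
  qed
  finally show ?thesis
    unfolding surface_lift_eq[OF z l] lift_ij_def x_def y_def .
qed

end

theorem proposition3p6:
  fixes k :: nat and c l \<omega> :: complex and U :: "complex set"
    and F :: "complex \<Rightarrow> complex \<Rightarrow> mat2"
    and \<ff> :: "complex \<Rightarrow> vec4" and f :: "complex \<Rightarrow> vec4 set"
  assumes "c \<in> UNIV - (unit_circle \<union> {0})"
    and "open U" and "connected U" and "0 \<in> U"
    and "extended_frame k c U F"
    and "l \<in> unit_circle" and "\<omega> \<in> unit_circle"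
    and "\<ff> = (\<lambda>z. \<omega> *s surface_lift F l z)"
    and "f = (\<lambda>z. proj (\<ff> z))"
  shows "minimal_lagrangian_Q2star U f \<ff> \<and>
    (\<forall>m\<in>{0..k + 1}. \<forall>z. reflection k m z \<in> U \<and> cnj z \<in> U \<longrightarrow>
       \<ff> (reflection k m z) = symmetry_matrix k m *v \<ff> (cnj z)) \<and>
    (\<exists>\<rho> :: real \<Rightarrow> real. \<forall>z\<in>U. \<forall>v w.
       induced_metric \<ff> z v w = \<rho> (cmod z) * Re (v * cnj w))"
proof -
  obtain \<Phi> C where "radial_frame k c U F \<Phi> C"
    by (rule extended_frame_imp_radial_frame[OF assms(2,5)])
  then interpret radial_frame k c U F \<Phi> C .
  have "minimal_lagrangian_Q2star U f \<ff>"
    unfolding assms(8,9) by (rule minimal_lagrangian_lift[OF assms(3,4,6,7)])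
  moreover have "\<ff> (reflection k m z) = symmetry_matrix k m *v \<ff> (cnj z)"
    if "reflection k m z \<in> U" "cnj z \<in> U" for m z
    unfolding assms(8) lift_symmetry[OF that(2,1) assms(6)]
    by (simp add: vec_eq_iff matrix_vector_mult_def sum_distrib_left mult_ac)
  moreover obtain \<rho> where "\<And>z. z \<in> U \<Longrightarrow> conformal_factor z = \<rho> (norm z)"
    by (rule conformal_factor_radial) (rule that)
  then have "\<forall>z\<in>U. \<forall>v w. induced_metric \<ff> z v w = \<rho> (cmod z) * Re (v * cnj w)"
    using induced_metric_lift[OF assms(3,4,6,7)] unfolding assms(8) by simp
  ultimately show ?thesis by blast
qed

end
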